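(* Let $u$ and $v$ be inner functions on the open unit disk $\mathbb{D}$. If $\mathscr{M}(u,v) \neq \{0\}$, then $\sigma(u) \subseteq \sigma(v)$.
   Context: $\mathbb{D}$ is the open unit disk, $\mathbb{T}$ the unit circle, $H^2$ the Hardy space of $\mathbb{D}$, and $\operatorname{Hol}(\mathbb{D})$ the space of analytic functions on $\mathbb{D}$. For an inner function $\Theta$ on $\mathbb{D}$, the model space is $\mathcal{K}_{\Theta} := H^2 \cap (\Theta H^2)^{\perp}$. For inner functions $u,v$, the set of multipliers from $\mathcal{K}_u$ to $\mathcal{K}_v$ is $\mathscr{M}(u,v) := \{\varphi \in \operatorname{Hol}(\mathbb{D}) : \varphi \mathcal{K}_u \subseteq \mathcal{K}_v\}$. The boundary spectrum of an inner function $u$ is $\sigma(u) := \{\xi \in \mathbb{T} : \liminf_{z \to \xi,\ z\in\mathbb{D}} |u(z)| = 0\}$. *)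

theory Defs
  imports "HOL-Complex_Analysis.Complex_Analysis"
begin

abbreviation unit_disk :: "complex set" where
  "unit_disk \<equiv> ball 0 1"

abbreviation unit_circle :: "complex set" where
  "unit_circle \<equiv> sphere 0 1"

text \<open>
  A function on the disk is represented by its extension by zero to the whole plane, so that two
  elements of \<open>Hol_disk\<close> are equal iff they agree on the disk; in particular \<open>\<lambda>_. 0\<close>
  is the only representative of the zero function.
\<close>
definition Hol_disk :: "(complex \<Rightarrow> complex) set" where
  "Hol_disk = {f. f holomorphic_on unit_disk \<and> (\<forall>z. z \<notin> unit_disk \<longrightarrow> f z = 0)}"

text \<open>
  The Hardy space is taken in its power series form: square-summable Taylor coefficients at \<open>0\<close>,
  with the \<open>\<ell>\<^sup>2\<close> inner product of the coefficient sequences.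
\<close>
definition taylor_coeff :: "(complex \<Rightarrow> complex) \<Rightarrow> nat \<Rightarrow> complex" where
  "taylor_coeff f n = fps_nth (fps_expansion f 0) n"

definition H2 :: "(complex \<Rightarrow> complex) set" where
  "H2 = {f \<in> Hol_disk. summable (\<lambda>n. (norm (taylor_coeff f n))\<^sup>2)}"

definition H2_inner :: "(complex \<Rightarrow> complex) \<Rightarrow> (complex \<Rightarrow> complex) \<Rightarrow> complex" where
  "H2_inner f g = (\<Sum>n. taylor_coeff f n * cnj (taylor_coeff g n))"

text \<open>
  Bounded analytic with unimodular radial limits almost everywhere. Unimodular constants are
  included. Values off the disk are irrelevant here and are left unconstrained.
\<close>
definition inner_function :: "(complex \<Rightarrow> complex) \<Rightarrow> bool" where
  "inner_function u \<longleftrightarrow>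
     u holomorphic_on unit_disk \<and> bounded (u ` unit_disk) \<and>
     (AE t in lebesgue_on {0..2 * pi}.
        \<exists>\<zeta>. norm \<zeta> = 1 \<and> ((\<lambda>r::real. u (of_real r * cis t)) \<longlongrightarrow> \<zeta>) (at_left 1))"

definition H2_perp :: "(complex \<Rightarrow> complex) set \<Rightarrow> (complex \<Rightarrow> complex) set" where
  "H2_perp S = {f \<in> H2. \<forall>g\<in>S. H2_inner f g = 0}"

definition model_space :: "(complex \<Rightarrow> complex) \<Rightarrow> (complex \<Rightarrow> complex) set" where
  "model_space \<Theta> = H2 \<inter> H2_perp ((\<lambda>h z. \<Theta> z * h z) ` H2)"

definition multipliers ::
    "(complex \<Rightarrow> complex) \<Rightarrow> (complex \<Rightarrow> complex) \<Rightarrow> (complex \<Rightarrow> complex) set" where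
  "multipliers u v =
     {\<phi> \<in> Hol_disk. (\<lambda>f z. \<phi> z * f z) ` model_space u \<subseteq> model_space v}"

definition boundary_spectrum :: "(complex \<Rightarrow> complex) \<Rightarrow> complex set" where
  "boundary_spectrum u =
     {\<xi> \<in> unit_circle. Liminf (at \<xi> within unit_disk) (\<lambda>z. ereal (norm (u z))) = 0}"

end

theory Submission
  imports Defs
begin

text \<open>
  Suppose that \<open>\<phi> \<noteq> 0\<close> multiplies \<open>\<K>\<^sub>u\<close> into \<open>\<K>\<^sub>v\<close> and that \<open>\<xi>\<close> lies outside \<open>\<sigma>(v)\<close>. The
  point is that \<open>u\<close> then extends continuously to a neighbourhood of \<open>\<xi>\<close>; since \<open>|u| = 1\<close> almost
  everywhere on the circle, the extension has modulus \<open>1\<close> at \<open>\<xi>\<close>, so \<open>\<xi>\<close> lies outside \<open>\<sigma>(u)\<close> as well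
  (\<open>continuous_extension_not_in_boundary_spectrum\<close>).

  Near \<open>\<xi>\<close> the function \<open>v\<close> is bounded away from zero, so in the logarithmic coordinate
  \<open>z = exp (\<i>\<zeta>)\<close> both \<open>v\<close> and its Schwarz reflection \<open>1 / cnj v\<close> are bounded, on the two sides of the
  real line, and their boundary values agree almost everywhere. A Painleve type theorem
  (\<open>holomorphic_extends_across_real_line\<close>) glues them. Hence \<open>v\<close> continues to a
  holomorphic \<open>V\<close> around \<open>\<xi>\<close> with \<open>V z * cnj (V (1 / cnj z)) = 1\<close>
  (\<open>inner_function_extends\<close>).

  This identity cancels the pole of the reproducing kernel
  \<open>k\<^sub>z w = (1 - cnj (V z) * V w) / (1 - cnj z * w)\<close>, so \<open>k\<^sub>z\<close> is a bounded function on the disk,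
  uniformly in \<open>z\<close> near \<open>\<xi>\<close>, on both sides of the circle. Pairing with \<open>k\<^sub>z\<close> then continues every
  element of \<open>\<K>\<^sub>v\<close> to one and the same neighbourhood of \<open>\<xi>\<close> (\<open>model_space_extends\<close>).

  On the other side, the iterated backward shifts \<open>u\<^sub>k = S\<^sup>*\<^sup>k u\<close> with \<open>k \<ge> 1\<close> belong to \<open>\<K>\<^sub>u\<close>
  (\<open>backward_shift_in_model_space\<close>), which is where \<open>|u| = 1\<close> enters in the form
  \<open>\<langle>u, u g\<rangle> = cnj (g 0)\<close>. So all \<open>\<phi> * u\<^sub>k\<close> continue across \<open>\<xi>\<close>. If the \<open>m\<close>-th Taylor coefficient \<open>a\<close> of
  \<open>u\<close> is nonzero for some \<open>m \<ge> 1\<close>, the relation \<open>u\<^sub>m - z * u\<^sub>m\<^sub>+\<^sub>1 = a\<close> shows that \<open>\<phi>\<close> continues, and then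
  \<open>\<phi> * u\<close> continues because \<open>u = u 0 + z * u\<^sub>1\<close>. So \<open>u\<close> is a quotient of two functions
  holomorphic at \<open>\<xi>\<close>; being bounded, it has no pole there (\<open>bounded_quotient_extends\<close>).
\<close>

section \<open>Taylor coefficients on the disk\<close>

lemma taylor_coeff_conv_deriv: "taylor_coeff f n = (deriv ^^ n) f 0 / fact n"
  by (simp add: taylor_coeff_def fps_expansion_def)

lemma taylor_sums:
  assumes "F holomorphic_on unit_disk" "z \<in> unit_disk"
  shows "(\<lambda>n. taylor_coeff F n * z ^ n) sums F z"
  using holomorphic_power_series[OF assms] by (simp add: taylor_coeff_conv_deriv)

lemma taylor_summable_norm:
  assumes "F holomorphic_on unit_disk" "norm z < 1"
  shows "summable (\<lambda>n. norm (taylor_coeff F n * z ^ n))"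
proof -
  obtain r where r: "norm z < r" "r < 1" using dense assms(2) by blast
  have "summable (\<lambda>n. taylor_coeff F n * (of_real r) ^ n)"
    using taylor_sums[OF assms(1), of "of_real r"] r sums_summable norm_ge_zero[of z]
    by (auto simp del: norm_ge_zero)
  then show ?thesis
    by (rule powser_insidea) (use r in auto)
qed

lemma has_fps_expansion_taylor:
  assumes "F holomorphic_on unit_disk"
  shows "F has_fps_expansion fps_expansion F 0"
  by (rule has_fps_expansion_fps_expansion[of unit_disk]) (use assms in auto)

lemma taylor_coeff_eqI:
  assumes "F has_fps_expansion A"
  shows "taylor_coeff F n = fps_nth A n"
  using assms by (simp add: taylor_coeff_conv_deriv fps_nth_fps_expansion)

lemma taylor_coeff_cong:
  assumes "\<And>z. z \<in> unit_disk \<Longrightarrow> F z = G z"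
  shows "taylor_coeff F n = taylor_coeff G n"
proof -
  have "eventually (\<lambda>z. z \<in> unit_disk) (nhds (0::complex))"
    by (rule eventually_nhds_in_open) auto
  then have "eventually (\<lambda>z. F z = G z) (nhds 0)"
    by eventually_elim (use assms in auto)
  then have "fps_expansion F 0 = fps_expansion G 0"
    by (rule fps_expansion_cong)
  then show ?thesis by (simp add: taylor_coeff_def)
qed

lemma taylor_coeff_mult:
  assumes "F holomorphic_on unit_disk" "G holomorphic_on unit_disk"
  shows "taylor_coeff (\<lambda>z. F z * G z) n = (\<Sum>i=0..n. taylor_coeff F i * taylor_coeff G (n - i))"
proof -
  have "(\<lambda>z. F z * G z) has_fps_expansion (fps_expansion F 0 * fps_expansion G 0)"
    by (intro has_fps_expansion_mult has_fps_expansion_taylor assms)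
  from taylor_coeff_eqI[OF this] show ?thesis
    by (simp add: fps_mult_nth taylor_coeff_def)
qed

lemma taylor_coeff_power_series:
  fixes a :: "nat \<Rightarrow> complex"
  assumes sums: "\<And>z. norm z < 1 \<Longrightarrow> (\<lambda>n. a n * z ^ n) sums F z"
  shows "F holomorphic_on unit_disk" "taylor_coeff F n = a n"
proof -
  show hol: "F holomorphic_on unit_disk"
    by (rule power_series_holomorphic[of 0 1 a]) (use sums in auto)
  have "F has_fps_expansion Abs_fps a"
  proof (rule has_fps_expansionI)
    have "eventually (\<lambda>z. z \<in> unit_disk) (nhds (0::complex))"
      by (rule eventually_nhds_in_open) auto
    then show "\<forall>\<^sub>F u in nhds 0. (\<lambda>n. fps_nth (Abs_fps a) n * u ^ n) sums F u"
      by eventually_elim (use sums in auto)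
  qed
  from taylor_coeff_eqI[OF this] show "taylor_coeff F n = a n" by simp
qed


section \<open>Parseval on circles and multiplication by bounded functions\<close>

lemma circle_in_disk: "0 \<le> r \<Longrightarrow> r < 1 \<Longrightarrow> of_real r * cis t \<in> unit_disk"
  by (simp add: norm_mult)

lemma continuous_on_circle:
  assumes "F holomorphic_on unit_disk" "0 \<le> r" "r < 1"
  shows "continuous_on S (\<lambda>t. F (of_real r * cis t))"
  by (rule continuous_on_compose2[OF holomorphic_on_imp_continuous_on[OF assms(1)]])
     (use assms in \<open>auto intro!: continuous_intros circle_in_disk simp: norm_mult\<close>)

text \<open>
  Cauchy's formula for the \<open>n\<close>-th derivative at \<open>0\<close>, read as a Fourier coefficient.
\<close>
lemma integral_circle_taylor_coeff:
  assumes F: "F holomorphic_on unit_disk" and r: "0 < r" "r < 1"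
  shows "((\<lambda>t. F (of_real r * cis t) * cnj (cis t) ^ n) has_integral
           2 * pi * taylor_coeff F n * of_real r ^ n) {0..2 * pi}"
proof -
  have "((\<lambda>u. F u / (u - 0) ^ Suc n) has_contour_integral
          (2 * pi * \<i>) / fact n * (deriv ^^ n) F 0) (circlepath 0 r)"
  proof (rule Cauchy_has_contour_integral_higher_derivative_circlepath)
    show "continuous_on (cball 0 r) F" "F holomorphic_on ball 0 r"
      using r by (auto intro!: holomorphic_on_imp_continuous_on holomorphic_on_subset[OF F])
  qed (use r in auto)
  then have "((\<lambda>t. F (of_real r * cis t) / (of_real r * cis t) ^ Suc n * r * \<i> * cis t) has_integral
      (2 * pi * \<i>) * taylor_coeff F n) {0..2 * pi}"
    unfolding circlepath_def 
    by (subst (asm) has_contour_integral_part_circlepath_iff) (auto simp: taylor_coeff_conv_deriv)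
  from has_integral_mult_right[OF this, of "of_real r ^ n / \<i>"]
  have "((\<lambda>t. of_real r ^ n / \<i> * (F (of_real r * cis t) / (of_real r * cis t) ^ Suc n * r * \<i> * cis t)) has_integral
      2 * pi * taylor_coeff F n * of_real r ^ n) {0..2 * pi}"
    by (simp add: mult_ac)
  moreover have "of_real r ^ n / \<i> * (F (of_real r * cis t) / (of_real r * cis t) ^ Suc n * r * \<i> * cis t)
      = F (of_real r * cis t) * cnj (cis t) ^ n" for t
  proof -
    have "cnj (cis t) ^ n = inverse (cis t ^ n)" by (simp add: cis_cnj cis_inverse[symmetric] power_inverse del: cis_inverse)
    then show ?thesis using r
      by (simp add: power_mult_distrib field_simps)
  qed
  ultimately show ?thesis by simp
qed

text \<open>
  On a circle of radius \<open>r < 1\<close> the Taylor series of \<open>G\<close> converges uniformly, so it can be integrated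
  term by term against \<open>F\<close>; each term is a Fourier coefficient of \<open>F\<close>.
\<close>
lemma Parseval_circle:
  assumes F: "F holomorphic_on unit_disk" and G: "G holomorphic_on unit_disk" and r: "0 < r" "r < 1"
  shows "(\<lambda>n. taylor_coeff F n * cnj (taylor_coeff G n) * of_real (r ^ (2 * n))) sums
           (integral {0..2 * pi} (\<lambda>t. F (of_real r * cis t) * cnj (G (of_real r * cis t))) / (2 * pi))"
proof -
  define g where "g = (\<lambda>N t. \<Sum>n<N. taylor_coeff G n * (of_real r * cis t) ^ n)"
  have sumg: "summable (\<lambda>n. norm (taylor_coeff G n) * r ^ n)"
    using taylor_summable_norm[OF G, of "of_real r"] r by (simp add: norm_mult norm_power)
  have unif_g: "uniform_limit {0..2*pi} g (\<lambda>t. G (of_real r * cis t)) sequentially"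
  proof -
    have "uniform_limit {0..2*pi} g (\<lambda>t. \<Sum>n. taylor_coeff G n * (of_real r * cis t) ^ n) sequentially"
      unfolding g_def
      by (rule Weierstrass_m_test[OF _ sumg]) (use r in \<open>auto simp: norm_mult norm_power\<close>)
    moreover have "(\<Sum>n. taylor_coeff G n * (of_real r * cis t) ^ n) = G (of_real r * cis t)" for t
      using taylor_sums[OF G circle_in_disk, of r t] r by (simp add: sums_iff)
    ultimately show ?thesis by simp
  qed
  have bdF: "bounded ((\<lambda>t. F (of_real r * cis t)) ` {0..2*pi})"
    by (intro compact_imp_bounded compact_continuous_image continuous_on_circle F) (use r in auto)
  have bdG: "bounded ((\<lambda>t. cnj (G (of_real r * cis t))) ` {0..2*pi})"
    by (intro compact_imp_bounded compact_continuous_image continuous_on_cnj continuous_on_circle G) (use r in auto)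
  have unif: "uniform_limit {0..2*pi} (\<lambda>N t. F (of_real r * cis t) * cnj (g N t))
      (\<lambda>t. F (of_real r * cis t) * cnj (G (of_real r * cis t))) sequentially"
  proof -
    have "uniform_limit {0..2*pi} (\<lambda>N t. cnj (g N t)) (\<lambda>t. cnj (G (of_real r * cis t))) sequentially"
      by (rule bounded_linear.uniform_limit[OF bounded_linear_cnj unif_g])
    then show ?thesis
      by (intro uniform_lim_mult uniform_limit_const bdF bdG)
  qed
  have int: "((\<lambda>t. F (of_real r * cis t) * cnj (g N t)) has_integral
      (\<Sum>n<N. 2 * pi * (taylor_coeff F n * cnj (taylor_coeff G n) * of_real (r ^ (2 * n))))) {0..2*pi}" for N
  proof -
    have "((\<lambda>t. \<Sum>n<N. cnj (taylor_coeff G n) * of_real r ^ n * (F (of_real r * cis t) * cnj (cis t) ^ n)) has_integral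
      (\<Sum>n<N. cnj (taylor_coeff G n) * of_real r ^ n * (2 * pi * taylor_coeff F n * of_real r ^ n))) {0..2*pi}"
      by (intro has_integral_sum has_integral_mult_right integral_circle_taylor_coeff F r) auto
    moreover have "(\<Sum>n<N. cnj (taylor_coeff G n) * of_real r ^ n * (2 * pi * taylor_coeff F n * of_real r ^ n))
       = (\<Sum>n<N. 2 * pi * (taylor_coeff F n * cnj (taylor_coeff G n) * of_real (r ^ (2 * n))))"
      by (intro sum.cong refl) (simp add: power_mult power2_eq_square power_mult_distrib)
    moreover have "(\<Sum>n<N. cnj (taylor_coeff G n) * of_real r ^ n * (F (of_real r * cis t) * cnj (cis t) ^ n))
       = F (of_real r * cis t) * cnj (g N t)" for t
      by (simp add: g_def sum_distrib_left power_mult_distrib mult_ac)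
    ultimately show ?thesis by simp
  qed
  have cont: "continuous_on {0..2*pi} (\<lambda>t. F (of_real r * cis t) * cnj (g N t))" for N
    unfolding g_def
    by (intro continuous_intros continuous_on_circle F) (use r in auto)
  obtain I J where IJ: "\<And>n. ((\<lambda>t. F (of_real r * cis t) * cnj (g n t)) has_integral I n) {0..2*pi}"
      "((\<lambda>t. F (of_real r * cis t) * cnj (G (of_real r * cis t))) has_integral J) {0..2*pi}"
      "I \<longlonglongrightarrow> J"
    by (rule uniform_limit_integral[OF unif cont]) auto
  have "I = (\<lambda>N. \<Sum>n<N. 2 * pi * (taylor_coeff F n * cnj (taylor_coeff G n) * of_real (r ^ (2 * n))))"
    using has_integral_unique[OF IJ(1) int] by blast
  then have "(\<lambda>n. 2 * pi * (taylor_coeff F n * cnj (taylor_coeff G n) * of_real (r ^ (2 * n)))) sums J"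
    using IJ(3) unfolding sums_def by (simp only:)
  then have "(\<lambda>n. (2 * pi * (taylor_coeff F n * cnj (taylor_coeff G n) * of_real (r ^ (2 * n)))) / (2 * pi)) sums (J / (2 * pi))"
    by (rule sums_divide)
  then show ?thesis using IJ(2) by (simp add: integral_unique)
qed

lemma Parseval_circle_norm:
  assumes F: "F holomorphic_on unit_disk" and r: "0 < r" "r < 1"
  shows "(\<lambda>n. (norm (taylor_coeff F n))\<^sup>2 * r ^ (2 * n)) sums
           (integral {0..2 * pi} (\<lambda>t. (norm (F (of_real r * cis t)))\<^sup>2) / (2 * pi))"
proof -
  have "integral {0..2 * pi} (\<lambda>t. F (of_real r * cis t) * cnj (F (of_real r * cis t)))
    = of_real (integral {0..2 * pi} (\<lambda>t. (norm (F (of_real r * cis t)))\<^sup>2))"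
  proof -
    have "(\<lambda>t. (norm (F (of_real r * cis t)))\<^sup>2) integrable_on {0..2 * pi}"
      by (intro integrable_continuous_real continuous_intros continuous_on_circle F) (use r in auto)
    from integral_linear[OF this bounded_linear_of_real[where 'a = complex]]
    show ?thesis by (simp add: complex_norm_square[symmetric] o_def del: of_real_power)
  qed
  with Parseval_circle[OF F F r]
  have "(\<lambda>n. complex_of_real ((norm (taylor_coeff F n))\<^sup>2 * r ^ (2 * n))) sums
           of_real (integral {0..2 * pi} (\<lambda>t. (norm (F (of_real r * cis t)))\<^sup>2) / (2 * pi))"
    by (simp add: complex_norm_square[symmetric] del: of_real_power) 
  then show ?thesis by (simp only: sums_of_real_iff)
qed

lemma sum_le_of_Abel_bound:
  fixes a :: "nat \<Rightarrow> real"
  assumes nonneg: "\<And>n. 0 \<le> a n"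
    and bd: "\<And>r N. 0 < r \<Longrightarrow> r < 1 \<Longrightarrow> (\<Sum>n<N. a n * r ^ (2 * n)) \<le> C"
  shows "summable a" "suminf a \<le> C"
proof -
  have *: "(\<Sum>n<N. a n) \<le> C" for N
  proof (rule tendsto_le)
    have "((\<lambda>r. \<Sum>n<N. a n * r ^ (2 * n)) \<longlongrightarrow> (\<Sum>n<N. a n * 1 ^ (2 * n))) (at_left (1::real))"
      by (intro tendsto_intros)
    then show "((\<lambda>r. \<Sum>n<N. a n * r ^ (2 * n)) \<longlongrightarrow> (\<Sum>n<N. a n)) (at_left (1::real))" by simp
    show "((\<lambda>r. C) \<longlongrightarrow> C) (at_left (1::real))" by simp
    have "\<forall>\<^sub>F r in at_left (1::real). r \<in> {0<..<1}"
      by (rule eventually_at_left_real) simp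
    then show "\<forall>\<^sub>F r in at_left (1::real). (\<Sum>n<N. a n * r ^ (2 * n)) \<le> C"
      by eventually_elim (use bd in auto)
  qed simp
  show "summable a"
    by (rule summableI_nonneg_bounded[OF nonneg *])
  then show "suminf a \<le> C"
    by (rule suminf_le_const) (rule *)
qed

text \<open>
  The Taylor coefficients of \<open>u * g\<close> are controlled through Parseval: on every circle the \<open>L\<^sup>2\<close> norm of
  \<open>u * g\<close> is at most \<open>B\<close> times that of \<open>g\<close>, and the radius then tends to \<open>1\<close>.
\<close>
lemma bounded_mult_H2:
  assumes u: "u holomorphic_on unit_disk" and B: "\<And>z. z \<in> unit_disk \<Longrightarrow> norm (u z) \<le> B"
    and g: "g holomorphic_on unit_disk" and sg: "summable (\<lambda>n. (norm (taylor_coeff g n))\<^sup>2)"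
  shows "summable (\<lambda>n. (norm (taylor_coeff (\<lambda>z. u z * g z) n))\<^sup>2)"
    and "(\<Sum>n. (norm (taylor_coeff (\<lambda>z. u z * g z) n))\<^sup>2) \<le> B\<^sup>2 * (\<Sum>n. (norm (taylor_coeff g n))\<^sup>2)"
proof -
  let ?h = "\<lambda>z. u z * g z"
  have h: "?h holomorphic_on unit_disk" using u g by (intro holomorphic_intros)
  have bd: "(\<Sum>n<N. (norm (taylor_coeff ?h n))\<^sup>2 * r ^ (2 * n)) \<le> B\<^sup>2 * (\<Sum>n. (norm (taylor_coeff g n))\<^sup>2)"
    if r: "0 < r" "r < 1" for r N
  proof -
    have sh: "(\<lambda>n. (norm (taylor_coeff ?h n))\<^sup>2 * r ^ (2 * n)) sums
           (integral {0..2 * pi} (\<lambda>t. (norm (?h (of_real r * cis t)))\<^sup>2) / (2 * pi))"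
      by (rule Parseval_circle_norm[OF h r])
    have sg': "(\<lambda>n. (norm (taylor_coeff g n))\<^sup>2 * r ^ (2 * n)) sums
           (integral {0..2 * pi} (\<lambda>t. (norm (g (of_real r * cis t)))\<^sup>2) / (2 * pi))"
      by (rule Parseval_circle_norm[OF g r])
    have "(\<Sum>n<N. (norm (taylor_coeff ?h n))\<^sup>2 * r ^ (2 * n)) \<le> 
        integral {0..2 * pi} (\<lambda>t. (norm (?h (of_real r * cis t)))\<^sup>2) / (2 * pi)"
      using sum_le_suminf[OF sums_summable[OF sh], of "{..<N}"] sh r by (simp add: sums_iff)
    also have "\<dots> \<le> integral {0..2 * pi} (\<lambda>t. B\<^sup>2 * (norm (g (of_real r * cis t)))\<^sup>2) / (2 * pi)"
    proof (intro divide_right_mono integral_le)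
      show "(\<lambda>t. (norm (?h (of_real r * cis t)))\<^sup>2) integrable_on {0..2 * pi}"
        by (intro integrable_continuous_real continuous_intros continuous_on_circle u g) (use r in auto)
      show "(\<lambda>t. B\<^sup>2 * (norm (g (of_real r * cis t)))\<^sup>2) integrable_on {0..2 * pi}"
        by (intro integrable_continuous_real continuous_intros continuous_on_circle u g) (use r in auto)
      show "(norm (?h (of_real r * cis t)))\<^sup>2 \<le> B\<^sup>2 * (norm (g (of_real r * cis t)))\<^sup>2" for t
        using B[OF circle_in_disk[of r t]] r
        by (auto simp: norm_mult power_mult_distrib intro!: mult_right_mono power_mono)
    qed auto
    also have "\<dots> = B\<^sup>2 * (\<Sum>n. (norm (taylor_coeff g n))\<^sup>2 * r ^ (2 * n))"
      using sg' by (simp add: sums_iff)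
    also have "\<dots> \<le> B\<^sup>2 * (\<Sum>n. (norm (taylor_coeff g n))\<^sup>2)"
      by (intro mult_left_mono suminf_le sums_summable[OF sg'] sg)
         (use r in \<open>auto intro!: mult_left_le power_le_one\<close>)
    finally show ?thesis .
  qed
  show "summable (\<lambda>n. (norm (taylor_coeff ?h n))\<^sup>2)"
       "(\<Sum>n. (norm (taylor_coeff ?h n))\<^sup>2) \<le> B\<^sup>2 * (\<Sum>n. (norm (taylor_coeff g n))\<^sup>2)"
    by (rule sum_le_of_Abel_bound[OF _ bd]; simp)+
qed

lemma taylor_coeff_1: "taylor_coeff (\<lambda>_. 1) n = (if n = 0 then 1 else 0)"
  using taylor_coeff_eqI[OF has_fps_expansion_1, of n] by simp

lemma bounded_summable_taylor:
  assumes u: "u holomorphic_on unit_disk" and B: "\<And>z. z \<in> unit_disk \<Longrightarrow> norm (u z) \<le> B"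
  shows "summable (\<lambda>n. (norm (taylor_coeff u n))\<^sup>2)"
    and "(\<Sum>n. (norm (taylor_coeff u n))\<^sup>2) \<le> B\<^sup>2"
proof -
  have e: "(\<lambda>n. (norm (taylor_coeff (\<lambda>_. 1) n))\<^sup>2) = (\<lambda>n. if n = 0 then 1 else 0)"
    by (auto simp: taylor_coeff_1)
  have s: "(\<lambda>n. (norm (taylor_coeff (\<lambda>_. 1) n))\<^sup>2) sums 1"
    unfolding e using sums_single[of 0 "\<lambda>_. 1::real"] by simp
  show "summable (\<lambda>n. (norm (taylor_coeff u n))\<^sup>2)" "(\<Sum>n. (norm (taylor_coeff u n))\<^sup>2) \<le> B\<^sup>2"
    using bounded_mult_H2[OF u B holomorphic_on_const sums_summable[OF s]] s by (simp_all add: sums_iff)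
qed

lemma summable_l2_mult:
  fixes a b :: "nat \<Rightarrow> complex"
  assumes "summable (\<lambda>n. (norm (a n))\<^sup>2)" "summable (\<lambda>n. (norm (b n))\<^sup>2)"
  shows "summable (\<lambda>n. norm (a n * b n))"
proof (rule summable_comparison_test')
  show "summable (\<lambda>n. (norm (a n))\<^sup>2 + (norm (b n))\<^sup>2)"
    by (intro summable_add assms)
  show "norm (norm (a n * b n)) \<le> (norm (a n))\<^sup>2 + (norm (b n))\<^sup>2" if "n \<ge> 0" for n
  proof -
    have "0 \<le> norm (a n) * norm (b n)" by simp
    then show ?thesis
      using sum_squares_bound[of "norm (a n)" "norm (b n)"] unfolding real_norm_def abs_norm_cancel norm_mult
      by linarith
  qed
qed

section \<open>Inner functions are orthogonal to their proper multiples\<close>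

text \<open>
  The pointwise condition that \<open>inner_function\<close> imposes almost everywhere on \<open>[0, 2\<pi>]\<close>, named so that
  it can be transported to all real angles.
\<close>
definition unimodular_radial_limit :: "(complex \<Rightarrow> complex) \<Rightarrow> real \<Rightarrow> bool" where
  "unimodular_radial_limit u t \<longleftrightarrow>
     (\<exists>\<zeta>. norm \<zeta> = 1 \<and> ((\<lambda>r::real. u (of_real r * cis t)) \<longlongrightarrow> \<zeta>) (at_left 1))"

text \<open>
  Periodicity carries the almost everywhere statement from \<open>[0, 2\<pi>]\<close> to the real line, which avoids
  a case distinction at the point \<open>1\<close> of the circle later.
\<close>
lemma inner_function_negligible_exceptional_set:
  assumes "inner_function u"
  shows "negligible {t. \<not> unimodular_radial_limit u t}"
proof -
  let ?P = "unimodular_radial_limit u"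
  define N where "N = {t \<in> {0..2*pi}. \<not> ?P t}"
  have "AE t in lebesgue_on {0..2*pi}. ?P t"
    using assms by (simp add: inner_function_def unimodular_radial_limit_def)
  then have "AE t in lebesgue. t \<in> {0..2*pi} \<longrightarrow> ?P t"
    by (subst (asm) AE_restrict_space_iff) auto
  then obtain N' where N': "negligible N'" "{t. \<not> (t \<in> {0..2*pi} \<longrightarrow> ?P t)} \<subseteq> N'"
    unfolding eventually_ae_filter_negligible by blast
  then have N: "negligible N"
    using N'(2) by (auto intro!: negligible_subset[OF N'(1)] simp: N_def)
  have "negligible (\<Union>k::int. (+) (2 * pi * of_int k) ` N)"
    using negligible_translation[OF N] by (auto simp: negligible_iff_null_sets)
  moreover have "{t. \<not> ?P t} \<subseteq> (\<Union>k::int. (+) (2 * pi * of_int k) ` N)"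
  proof
    fix t assume t: "t \<in> {t. \<not> ?P t}"
    define k where "k = \<lfloor>t / (2*pi)\<rfloor>"
    define s where "s = t - 2 * pi * of_int k"
    have k: "of_int k \<le> t / (2*pi)" "t / (2*pi) < of_int k + 1"
      unfolding k_def by linarith+
    have "s \<in> {0..2*pi}" using k by (auto simp: s_def field_simps)
    moreover have "cis s = cis t"
    proof -
      have "cis s = cis t * cis (- (2 * pi * of_int k))"
        unfolding s_def cis_mult by simp
      also have "cis (- (2 * pi * of_int k)) = 1"
        using cis_multiple_2pi[of "of_int (-k)"] by simp
      finally show ?thesis by simp
    qed
    ultimately have "s \<in> N" using t by (simp add: N_def unimodular_radial_limit_def)
    then show "t \<in> (\<Union>k::int. (+) (2 * pi * of_int k) ` N)"
      by (auto simp: s_def intro!: exI[of _ k] image_eqI[of _ _ s])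
  qed
  ultimately show ?thesis by (rule negligible_subset)
qed

lemma integral_bounded_tendsto_0:
  fixes f :: "nat \<Rightarrow> real \<Rightarrow> 'a::euclidean_space"
  assumes cont: "\<And>k. continuous_on {a..b} (f k)"
    and bd: "\<And>k t. t \<in> {a..b} \<Longrightarrow> norm (f k t) \<le> B"
    and N: "negligible N" and lim: "\<And>t. t \<in> {a..b} - N \<Longrightarrow> (\<lambda>k. f k t) \<longlonglongrightarrow> 0"
  shows "(\<lambda>k. integral {a..b} (f k)) \<longlonglongrightarrow> 0"
proof -
  let ?S = "{a..b} - N"
  have neg: "negligible ({x \<in> {a..b} - ?S. g x \<noteq> 0})" "negligible {x \<in> ?S - {a..b}. g x \<noteq> 0}" 
    for g :: "real \<Rightarrow> 'b::real_normed_vector"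
    by (auto intro: negligible_subset[OF N])
  have int: "(f k) integrable_on ?S" for k
    using integrable_spike_set[OF integrable_continuous_real[OF cont[of k]] neg] .
  have intB: "(\<lambda>t. B) integrable_on ?S"
    using integrable_spike_set[OF integrable_continuous_real[OF continuous_on_const] neg] .
  have "(\<lambda>k. integral ?S (f k)) \<longlonglongrightarrow> integral ?S (\<lambda>t. 0)"
    by (rule dominated_convergence(2)[OF int intB]) (use bd lim in auto)
  moreover have "integral ?S (f k) = integral {a..b} (f k)" for k
    by (rule integral_spike_set) (auto intro: negligible_subset[OF N])
  ultimately show ?thesis by simp
qed

lemma Abel_radial_limit:
  fixes c :: "nat \<Rightarrow> complex"
  assumes c: "summable (\<lambda>n. norm (c n))" and \<rho>: "\<rho> \<longlonglongrightarrow> 1" "\<And>k. 0 < \<rho> k" "\<And>k. \<rho> k < (1::real)"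
  shows "(\<lambda>k. \<Sum>n. c n * of_real (\<rho> k ^ (2 * n))) \<longlonglongrightarrow> (\<Sum>n. c n)"
proof -
  let ?f = "\<lambda>N r. \<Sum>n<N. c n * complex_of_real (r ^ (2 * n))"
  have "uniform_limit {0..1} ?f (\<lambda>r. \<Sum>n. c n * complex_of_real (r ^ (2 * n))) sequentially"
    by (rule Weierstrass_m_test[OF _ c])
       (auto simp: norm_mult norm_power intro!: mult_left_le power_le_one)
  then have "continuous_on {0..1} (\<lambda>r. \<Sum>n. c n * complex_of_real (r ^ (2 * n)))"
    by (rule uniform_limit_theorem[rotated]) (auto intro!: always_eventually continuous_intros)
  then have "(\<lambda>k. \<Sum>n. c n * complex_of_real (\<rho> k ^ (2 * n))) \<longlonglongrightarrow> (\<Sum>n. c n * complex_of_real (1 ^ (2 * n)))"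
    by (rule continuous_on_tendsto_compose) (use \<rho> in \<open>auto intro!: always_eventually less_imp_le\<close>)
  then show ?thesis by simp
qed

lemma inner_function_bound:
  assumes "inner_function u"
  obtains B where "0 < B" "\<And>z. z \<in> unit_disk \<Longrightarrow> norm (u z) \<le> B"
  using assms unfolding inner_function_def bounded_pos by auto

text \<open>
  Formally this is \<open>\<integral>|u|\<^sup>2 cnj g = \<integral>cnj g\<close> on the unit circle. As \<open>g\<close> is only known inside the disk, the
  argument runs on circles of radius \<open>\<rho> \<rightarrow> 1\<close>: the error is the integral of \<open>(|u|\<^sup>2 - 1) * cnj g\<close>, where
  the first factor tends to \<open>0\<close> in \<open>L\<^sup>2\<close> by bounded convergence and the second stays bounded in \<open>L\<^sup>2\<close>.
\<close>
lemma inner_function_orthogonality: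
  assumes u: "inner_function u" and g: "g \<in> H2"
  shows "H2_inner u (\<lambda>z. u z * g z) = cnj (g 0)"
proof -
  define \<rho> where "\<rho> = (\<lambda>k::nat. 1 - inverse (real (Suc (Suc k))))"
  have \<rho>: "0 < \<rho> k" "\<rho> k < 1" for k by (auto simp: \<rho>_def field_simps)
  have \<rho>_lim: "\<rho> \<longlonglongrightarrow> 1"
  proof -
    have "\<rho> \<longlonglongrightarrow> 1 - 0"
      unfolding \<rho>_def
      using LIMSEQ_inverse_real_of_nat[THEN LIMSEQ_Suc] by (intro tendsto_intros)
    then show ?thesis by simp
  qed
  have \<rho>_left: "filterlim \<rho> (at_left 1) sequentially"
    unfolding filterlim_at using \<rho>_lim \<rho> by (auto simp: less_imp_neq)
  obtain B where B: "0 < B" "\<And>z. z \<in> unit_disk \<Longrightarrow> norm (u z) \<le> B"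
    by (rule inner_function_bound[OF u]) blast
  have hu: "u holomorphic_on unit_disk" using u by (simp add: inner_function_def)
  have hg: "g holomorphic_on unit_disk" and sg: "summable (\<lambda>n. (norm (taylor_coeff g n))\<^sup>2)"
    using g by (auto simp: H2_def Hol_disk_def)
  let ?h = "\<lambda>z. u z * g z"
  have hh: "?h holomorphic_on unit_disk" by (intro holomorphic_intros hu hg)
  define C where "C = (\<Sum>n. (norm (taylor_coeff g n))\<^sup>2)"
  define c where "c = (\<lambda>n. taylor_coeff u n * cnj (taylor_coeff ?h n))"
  have sc: "summable (\<lambda>n. norm (c n))"
    unfolding c_def
    by (rule summable_l2_mult) (use bounded_summable_taylor(1)[OF hu B(2)] bounded_mult_H2(1)[OF hu B(2) hg sg] in auto)
  define L where "L = (\<Sum>n. c n)"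
  define U where "U = (\<lambda>k t. (norm (u (of_real (\<rho> k) * cis t)))\<^sup>2 - 1)"
  define G where "G = (\<lambda>k t. g (of_real (\<rho> k) * cis t))"
  have contU: "continuous_on S (U k)" for S k
    unfolding U_def by (intro continuous_intros continuous_on_circle hu) (use \<rho> in \<open>auto simp: less_imp_le\<close>)
  have contG: "continuous_on S (G k)" for S k
    unfolding G_def by (intro continuous_intros continuous_on_circle hg) (use \<rho> in \<open>auto simp: less_imp_le\<close>)
  have diff: "(\<Sum>n. c n * of_real (\<rho> k ^ (2 * n))) - cnj (g 0)
      = integral {0..2*pi} (\<lambda>t. of_real (U k t) * cnj (G k t)) / (2 * pi)" for k
  proof -
    have 1: "(\<Sum>n. c n * of_real (\<rho> k ^ (2 * n))) =
      integral {0..2 * pi} (\<lambda>t. u (of_real (\<rho> k) * cis t) * cnj (?h (of_real (\<rho> k) * cis t))) / (2 * pi)"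
      using Parseval_circle[OF hu hh \<rho>[of k]] by (simp add: sums_iff c_def)
    have g0: "taylor_coeff g 0 = g 0" by (simp add: taylor_coeff_conv_deriv)
    have "(\<lambda>n. taylor_coeff (\<lambda>_. 1) n * cnj (taylor_coeff g n) * of_real (\<rho> k ^ (2 * n))) = (\<lambda>n. if n = 0 then cnj (g 0) else 0)"
      by (auto simp: taylor_coeff_1 g0)
    then have "cnj (g 0) = (\<Sum>n. taylor_coeff (\<lambda>_. 1) n * cnj (taylor_coeff g n) * of_real (\<rho> k ^ (2 * n)))"
      using sums_single[of 0 "\<lambda>_. cnj (g 0)"] by (simp add: sums_iff)
    also have "\<dots> = integral {0..2 * pi} (\<lambda>t. cnj (g (of_real (\<rho> k) * cis t))) / (2 * pi)"
      using Parseval_circle[OF holomorphic_on_const hg \<rho>[of k], of 1] by (simp add: sums_iff)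
    finally have 2: "cnj (g 0) = integral {0..2 * pi} (\<lambda>t. cnj (g (of_real (\<rho> k) * cis t))) / (2 * pi)" .
    have "integral {0..2 * pi} (\<lambda>t. u (of_real (\<rho> k) * cis t) * cnj (?h (of_real (\<rho> k) * cis t)))
      - integral {0..2 * pi} (\<lambda>t. cnj (g (of_real (\<rho> k) * cis t)))
      = integral {0..2 * pi} (\<lambda>t. u (of_real (\<rho> k) * cis t) * cnj (?h (of_real (\<rho> k) * cis t)) - cnj (g (of_real (\<rho> k) * cis t)))"
      by (intro integral_diff[symmetric] integrable_continuous_real continuous_intros continuous_on_circle hu hg)
         (use \<rho> in \<open>auto simp: less_imp_le\<close>)
    also have "\<dots> = integral {0..2*pi} (\<lambda>t. of_real (U k t) * cnj (G k t))"
      by (intro integral_cong) (simp add: U_def G_def complex_norm_square algebra_simps del: of_real_power)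
    finally show ?thesis
      unfolding 1 2 by (simp add: diff_divide_distrib[symmetric])
  qed
  have intG: "integral {0..2*pi} (\<lambda>t. (norm (G k t))\<^sup>2) \<le> 2 * pi * C" for k
  proof -
    note P = Parseval_circle_norm[OF hg \<rho>[of k]]
    have "integral {0..2 * pi} (\<lambda>t. (norm (G k t))\<^sup>2) / (2 * pi) =
      (\<Sum>n. (norm (taylor_coeff g n))\<^sup>2 * \<rho> k ^ (2 * n))"
      using P by (simp add: sums_iff G_def)
    also have "\<dots> \<le> C" unfolding C_def
      by (intro suminf_le sums_summable[OF P] sg mult_left_le power_le_one) (use \<rho>[of k] in auto)
    finally show ?thesis by (simp add: field_simps)
  qed
  define D where "D = (\<lambda>k. integral {0..2*pi} (\<lambda>t. (U k t)\<^sup>2))"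
  have D: "D \<longlonglongrightarrow> 0"
    unfolding D_def
  proof (rule integral_bounded_tendsto_0[OF _ _ inner_function_negligible_exceptional_set[OF u]])
    show "continuous_on {0..2*pi} (\<lambda>t. (U k t)\<^sup>2)" for k by (intro continuous_intros contU)
    show "norm ((U k t)\<^sup>2) \<le> (B\<^sup>2 + 1)\<^sup>2" for k t
    proof -
      have "norm (u (of_real (\<rho> k) * cis t)) \<le> B"
        by (intro B(2) circle_in_disk) (use \<rho> in \<open>auto simp: less_imp_le\<close>)
      then have "(norm (u (of_real (\<rho> k) * cis t)))\<^sup>2 \<le> B\<^sup>2" by (intro power_mono) auto
      then have "\<bar>U k t\<bar> \<le> B\<^sup>2 + 1" unfolding U_def
        by (smt (verit) zero_le_power2)
      then have "\<bar>U k t\<bar>\<^sup>2 \<le> (B\<^sup>2 + 1)\<^sup>2" by (rule power_mono) simp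
      then show ?thesis by simp
    qed
    fix t assume "t \<in> {0..2*pi} - {t. \<not> unimodular_radial_limit u t}"
    then obtain \<zeta> where \<zeta>: "norm \<zeta> = 1" "((\<lambda>r::real. u (of_real r * cis t)) \<longlongrightarrow> \<zeta>) (at_left 1)"
      by (auto simp: unimodular_radial_limit_def)
    have "(\<lambda>k. u (of_real (\<rho> k) * cis t)) \<longlonglongrightarrow> \<zeta>"
      using filterlim_compose[OF \<zeta>(2) \<rho>_left] by (simp add: o_def)
    then have "(\<lambda>k. (U k t)\<^sup>2) \<longlonglongrightarrow> ((norm \<zeta>)\<^sup>2 - 1)\<^sup>2"
      unfolding U_def by (intro tendsto_intros)
    then show "(\<lambda>k. (U k t)\<^sup>2) \<longlonglongrightarrow> 0" by (simp add: \<zeta>)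
  qed
  \<comment> \<open>The weight \<open>s\<close> stands in for the Cauchy--Schwarz inequality: \<open>|x y| \<le> x\<^sup>2 / s + s y\<^sup>2\<close>, and \<open>s \<rightarrow> 0\<close> after \<open>k \<rightarrow> \<infinity>\<close>.\<close>
  have bound: "norm ((\<Sum>n. c n * of_real (\<rho> k ^ (2 * n))) - cnj (g 0)) \<le> (D k / s + s * (2 * pi * C)) / (2 * pi)"
    if s: "s > 0" for s k
  proof -
    have "norm (integral {0..2*pi} (\<lambda>t. of_real (U k t) * cnj (G k t)))
      \<le> integral {0..2*pi} (\<lambda>t. (U k t)\<^sup>2 / s + s * (norm (G k t))\<^sup>2)"
    proof (rule integral_norm_bound_integral)
      show "(\<lambda>t. of_real (U k t) * cnj (G k t)) integrable_on {0..2*pi}"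
        by (intro integrable_continuous_real continuous_intros contU contG)
      show "(\<lambda>t. (U k t)\<^sup>2 / s + s * (norm (G k t))\<^sup>2) integrable_on {0..2*pi}"
        by (intro integrable_continuous_real continuous_intros contU contG) (use s in auto)
      fix t
      let ?x = "\<bar>U k t\<bar>" let ?y = "norm (G k t)"
      have "2 * (?x * (s * ?y)) \<le> ?x\<^sup>2 + (s * ?y)\<^sup>2"
        using sum_squares_bound[of ?x "s * ?y"] by simp
      moreover have "0 \<le> ?x * (s * ?y)" using s by simp
      ultimately have "?x * (s * ?y) \<le> ?x\<^sup>2 + (s * ?y)\<^sup>2" by linarith
      then have "?x * (s * ?y) / s \<le> (?x\<^sup>2 + (s * ?y)\<^sup>2) / s" using s by (intro divide_right_mono) auto
      then have "?x * ?y \<le> ?x\<^sup>2 / s + s * ?y\<^sup>2" using s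
        by (simp add: add_divide_distrib power_mult_distrib power2_eq_square mult_ac)
      then show "norm (of_real (U k t) * cnj (G k t)) \<le> (U k t)\<^sup>2 / s + s * (norm (G k t))\<^sup>2"
        by (simp add: norm_mult)
    qed
    also have "\<dots> = D k / s + s * integral {0..2*pi} (\<lambda>t. (norm (G k t))\<^sup>2)"
    proof -
      have "(\<lambda>t. (U k t)\<^sup>2) integrable_on {0..2*pi}" "(\<lambda>t. (norm (G k t))\<^sup>2) integrable_on {0..2*pi}"
        by (intro integrable_continuous_real continuous_intros contU contG)+
      then show ?thesis
        unfolding D_def
        by (subst integral_add) (auto simp: integrable_on_divide integrable_on_mult_right)
    qed
    also have "\<dots> \<le> D k / s + s * (2 * pi * C)" using intG[of k] s by simp
    finally show ?thesis unfolding diff norm_divide by (simp add: divide_right_mono)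
  qed
  have "norm (L - cnj (g 0)) \<le> s * C" if s: "s > 0" for s
  proof (rule tendsto_le)
    show "(\<lambda>k. norm ((\<Sum>n. c n * of_real (\<rho> k ^ (2 * n))) - cnj (g 0))) \<longlonglongrightarrow> norm (L - cnj (g 0))"
      unfolding L_def by (intro tendsto_intros Abel_radial_limit sc \<rho>_lim \<rho>)
    have "(\<lambda>k. (D k / s + s * (2 * pi * C)) / (2 * pi)) \<longlonglongrightarrow> (0 / s + s * (2 * pi * C)) / (2 * pi)"
      by (intro tendsto_intros D) (use s in auto)
    then show "(\<lambda>k. (D k / s + s * (2 * pi * C)) / (2 * pi)) \<longlonglongrightarrow> s * C" by simp
    show "\<forall>\<^sub>F k in sequentially. norm ((\<Sum>n. c n * of_real (\<rho> k ^ (2 * n))) - cnj (g 0)) \<le> (D k / s + s * (2 * pi * C)) / (2 * pi)"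
      using bound[OF s] by simp
  qed simp
  note small = this
  have "norm (L - cnj (g 0)) \<le> 0"
  proof (rule tendsto_lowerbound)
    have "((\<lambda>s. s * C) \<longlongrightarrow> 0 * C) (at_right 0)" by (intro tendsto_intros)
    then show "((\<lambda>s. s * C) \<longlongrightarrow> 0) (at_right 0)" by simp
    show "\<forall>\<^sub>F s in at_right 0. norm (L - cnj (g 0)) \<le> s * C"
      using eventually_at_right_less[of 0] by eventually_elim (use small in auto)
  qed simp
  then show ?thesis by (simp add: H2_inner_def L_def c_def)
qed

section \<open>Backward shifts in the model space\<close>

text \<open>
  The \<open>k\<close>-th iterate of the backward shift, that is \<open>(u z - p z) / z ^ k\<close> with \<open>p\<close> the Taylor polynomial
  of degree below \<open>k\<close>. The series form has no singularity at \<open>0\<close>, and the value \<open>0\<close> off the disk makes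
  it an element of \<open>Hol_disk\<close>.
\<close>
definition backward_shift :: "nat \<Rightarrow> (complex \<Rightarrow> complex) \<Rightarrow> complex \<Rightarrow> complex" where
  "backward_shift k u z = (if z \<in> unit_disk then \<Sum>n. taylor_coeff u (n + k) * z ^ n else 0)"

lemma backward_shift_sums:
  assumes u: "u holomorphic_on unit_disk" and z: "norm z < 1"
  shows "(\<lambda>n. taylor_coeff u (n + k) * z ^ n) sums backward_shift k u z"
proof -
  have "summable (\<lambda>n. taylor_coeff u (n + k) * z ^ n)"
  proof (cases "z = 0")
    case True
    then show ?thesis by simp
  next
    case False
    have "summable (\<lambda>n. taylor_coeff u n * z ^ n)"
      using taylor_sums[OF u, of z] z by (auto simp: sums_iff)
    then have "summable (\<lambda>n. taylor_coeff u (n + k) * z ^ (n + k) / z ^ k)"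
      by (intro summable_divide summable_ignore_initial_segment)
    then show ?thesis using False by (simp add: power_add)
  qed
  then show ?thesis using z by (simp add: backward_shift_def sums_iff)
qed

lemma
  assumes "u holomorphic_on unit_disk"
  shows holomorphic_backward_shift: "backward_shift k u holomorphic_on unit_disk"
    and taylor_coeff_backward_shift: "taylor_coeff (backward_shift k u) n = taylor_coeff u (n + k)"
  using taylor_coeff_power_series[of "\<lambda>n. taylor_coeff u (n + k)", OF backward_shift_sums[OF assms]]
  by blast+

lemma backward_shift_Suc:
  assumes u: "u holomorphic_on unit_disk" and z: "z \<in> unit_disk"
  shows "z * backward_shift (Suc k) u z = backward_shift k u z - taylor_coeff u k"
proof -
  have z': "norm z < 1" using z by simp
  have "(\<lambda>n. z * (taylor_coeff u (n + Suc k) * z ^ n)) sums (z * backward_shift (Suc k) u z)"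
    by (intro sums_mult backward_shift_sums u z')
  then have "(\<lambda>n. taylor_coeff u (Suc n + k) * z ^ Suc n) sums (z * backward_shift (Suc k) u z)"
    by (simp add: mult_ac)
  then have "(\<lambda>n. taylor_coeff u (n + k) * z ^ n) sums (z * backward_shift (Suc k) u z + taylor_coeff u k)"
    by (subst (asm) sums_Suc_iff) simp
  from sums_unique2[OF this backward_shift_sums[OF u z']] show ?thesis
    by (simp add: algebra_simps)
qed

lemma backward_shift_0:
  assumes u: "u holomorphic_on unit_disk" and z: "z \<in> unit_disk"
  shows "backward_shift 0 u z = u z"
  using sums_unique2[OF backward_shift_sums[OF u, of z 0] ] taylor_sums[OF u z] z by simp

lemma taylor_coeff_power_mult:
  assumes F: "F holomorphic_on unit_disk"
  shows "taylor_coeff (\<lambda>z. z ^ k * F z) n = (if n < k then 0 else taylor_coeff F (n - k))"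
proof -
  have "(\<lambda>z. z ^ k * F z) has_fps_expansion (fps_X ^ k * fps_expansion F 0)"
    by (intro fps_expansion_intros has_fps_expansion_taylor F)
  from taylor_coeff_eqI[OF this] show ?thesis
    by (simp add: fps_X_power_mult_nth taylor_coeff_def)
qed

text \<open>
  Moving the shift to the other factor of the inner product turns the pairing with \<open>u * h\<close> into
  \<open>\<langle>u, u * (z ^ k * h)\<rangle>\<close>, the conjugate of the value of \<open>z ^ k * h\<close> at \<open>0\<close>, which vanishes for \<open>k > 0\<close>.
\<close>
lemma backward_shift_in_model_space:
  assumes u: "inner_function u" and k: "k > 0"
  shows "backward_shift k u \<in> model_space u"
proof -
  have hu: "u holomorphic_on unit_disk" using u by (simp add: inner_function_def)
  obtain B where B: "0 < B" "\<And>z. z \<in> unit_disk \<Longrightarrow> norm (u z) \<le> B"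
    by (rule inner_function_bound[OF u]) blast
  have su: "summable (\<lambda>n. (norm (taylor_coeff u n))\<^sup>2)"
    by (rule bounded_summable_taylor(1)[OF hu B(2)])
  have H2: "backward_shift k u \<in> H2"
  proof -
    have "backward_shift k u holomorphic_on unit_disk"
      by (rule holomorphic_backward_shift[OF hu])
    moreover have "summable (\<lambda>n. (norm (taylor_coeff (backward_shift k u) n))\<^sup>2)"
      unfolding taylor_coeff_backward_shift[OF hu] by (rule summable_ignore_initial_segment[OF su])
    ultimately show ?thesis by (auto simp: H2_def Hol_disk_def backward_shift_def)
  qed
  have "H2_inner (backward_shift k u) (\<lambda>z. u z * h z) = 0" if h: "h \<in> H2" for h
  proof -
    have hh: "h holomorphic_on unit_disk" and sh: "summable (\<lambda>n. (norm (taylor_coeff h n))\<^sup>2)"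
      and h0: "\<And>z. z \<notin> unit_disk \<Longrightarrow> h z = 0"
      using h by (auto simp: H2_def Hol_disk_def)
    have hm: "(\<lambda>z. u z * h z) holomorphic_on unit_disk" by (intro holomorphic_intros hu hh)
    define g where "g = (\<lambda>z. z ^ k * h z)"
    have g: "g \<in> H2"
    proof -
      have "summable (\<lambda>n. (norm (taylor_coeff g n))\<^sup>2)"
        by (subst summable_iff_shift[of _ k, symmetric])
           (use sh in \<open>simp add: g_def taylor_coeff_power_mult[OF hh]\<close>)
      then show ?thesis
        using h0 by (auto simp: H2_def Hol_disk_def g_def intro!: holomorphic_intros hh)
    qed
    have ug: "taylor_coeff (\<lambda>z. u z * g z) n = (if n < k then 0 else taylor_coeff (\<lambda>z. u z * h z) (n - k))" for n
      using taylor_coeff_power_mult[OF hm, of k n] by (simp add: g_def mult_ac)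
    have "summable (\<lambda>n. norm (taylor_coeff u n * cnj (taylor_coeff (\<lambda>z. u z * g z) n)))"
      using g bounded_mult_H2(1)[OF hu B(2), of g] by (intro summable_l2_mult su) (auto simp: H2_def Hol_disk_def)
    then have "(\<Sum>n. taylor_coeff u n * cnj (taylor_coeff (\<lambda>z. u z * g z) n)) =
        (\<Sum>n. taylor_coeff u (n + k) * cnj (taylor_coeff (\<lambda>z. u z * h z) n))"
      by (subst suminf_split_initial_segment[of _ k]) (auto simp: ug dest: summable_norm_cancel)
    then have "H2_inner (backward_shift k u) (\<lambda>z. u z * h z) = H2_inner u (\<lambda>z. u z * g z)"
      by (simp add: H2_inner_def taylor_coeff_backward_shift[OF hu])
    also have "\<dots> = 0"
      using inner_function_orthogonality[OF u g] k by (simp add: g_def)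
    finally show ?thesis .
  qed
  with H2 show ?thesis by (auto simp: model_space_def H2_perp_def)
qed

section \<open>Gluing bounded holomorphic functions along a line\<close>

text \<open>
  A bounded derivative makes the primitive Lipschitz, so it has continuous boundary values even where
  \<open>W\<close> itself has none.
\<close>
lemma bounded_primitive_extends:
  fixes W :: "complex \<Rightarrow> complex"
  assumes "convex S" "open S" "W holomorphic_on S" and M: "\<And>z. z \<in> S \<Longrightarrow> norm (W z) \<le> M"
  obtains P where "continuous_on (closure S) P" "\<And>z. z \<in> S \<Longrightarrow> (P has_field_derivative W z) (at z)"
proof -
  obtain Q where Q: "\<And>z. z \<in> S \<Longrightarrow> (Q has_field_derivative W z) (at z within S)"
    using holomorphic_convex_primitive'[OF assms(1-3)] by blast
  have "(max M 0)-lipschitz_on S Q"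
  proof (rule lipschitz_onI)
    fix x y assume "x \<in> S" "y \<in> S"
    then show "dist (Q x) (Q y) \<le> max M 0 * dist x y"
      unfolding dist_norm
      by (intro field_differentiable_bound[OF assms(1) Q]) (use M in \<open>auto simp: max.coboundedI1\<close>)
  qed simp
  then have "uniformly_continuous_on S Q" by (rule lipschitz_on_uniformly_continuous)
  then obtain P where P: "uniformly_continuous_on (closure S) P" "\<And>x. x \<in> S \<Longrightarrow> Q x = P x"
    by (rule uniformly_continuous_on_extension_on_closure) blast
  show ?thesis
  proof
    show "continuous_on (closure S) P" by (rule uniformly_continuous_imp_continuous[OF P(1)])
    fix z assume z: "z \<in> S"
    have "(Q has_field_derivative W z) (at z)" using Q[OF z] at_within_open[OF z assms(2)] by simp
    then show "(P has_field_derivative W z) (at z)"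
      by (rule has_field_derivative_transform_within_open[OF _ assms(2) z P(2)])
  qed
qed

lemma has_integral_horizontal:
  assumes "a \<le> b" and "\<And>s. s \<in> {a..b} \<Longrightarrow> (P has_field_derivative W (Complex s y)) (at (Complex s y))"
  shows "((\<lambda>s. W (Complex s y)) has_integral P (Complex b y) - P (Complex a y)) {a..b}"
proof (rule fundamental_theorem_of_calculus[OF assms(1)])
  fix s assume "s \<in> {a..b}"
  have "((\<lambda>s. Complex s y) has_vector_derivative 1) (at s)"
    unfolding Complex_eq by (auto intro!: derivative_eq_intros simp: has_vector_derivative_def scaleR_conv_of_real)
  from field_vector_diff_chain_at[OF this assms(2)] \<open>s \<in> {a..b}\<close>
  have "((\<lambda>s. P (Complex s y)) has_vector_derivative W (Complex s y)) (at s)"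
    by (simp add: o_def)
  then show "((\<lambda>s. P (Complex s y)) has_vector_derivative W (Complex s y)) (at s within {a..b})"
    by (rule has_vector_derivative_at_within)
qed

lemma derivative_imp_holomorphic:
  assumes "\<And>z. z \<in> S \<Longrightarrow> (f has_field_derivative f' z) (at z)"
  shows "f holomorphic_on S"
  unfolding holomorphic_on_def field_differentiable_def
  using assms has_field_derivative_at_within by blast

text \<open>
  The upper and lower primitives extend continuously to the real line. Along the line their increments
  are limits of integrals of \<open>W\<close> on horizontal segments just above and just below; by bounded convergence
  these agree in the limit, since the jump of \<open>W\<close> vanishes almost everywhere. After adding a constant the
  primitives therefore match on the line, the glued function is holomorphic, and its derivative
  continues \<open>W\<close>.
\<close>
lemma holomorphic_extends_across_real_line:
  fixes W :: "complex \<Rightarrow> complex" and x0 e :: real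
  defines "S \<equiv> ball (of_real x0) e"
  assumes hol: "W holomorphic_on S \<inter> {z. 0 < Im z}" "W holomorphic_on S \<inter> {z. Im z < 0}"
    and M: "\<And>z. z \<in> S \<Longrightarrow> Im z \<noteq> 0 \<Longrightarrow> norm (W z) \<le> M"
    and N: "negligible N"
    and jump: "\<And>x. x \<notin> N \<Longrightarrow> of_real x \<in> S \<Longrightarrow> ((\<lambda>y. W (Complex x y) - W (Complex x (-y))) \<longlongrightarrow> 0) (at_right 0)"
  obtains h where "h holomorphic_on S" "\<And>z. z \<in> S \<Longrightarrow> Im z \<noteq> 0 \<Longrightarrow> h z = W z"
proof -
  let ?U = "S \<inter> {z. 0 < Im z}" and ?L = "S \<inter> {z. Im z < 0}"
  have opS: "open S" and cvS: "convex S" by (auto simp: S_def)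
  have op: "open ?U" "open ?L"
    using opS by (auto intro!: open_Int open_halfspace_Im_gt open_halfspace_Im_lt)
  have cv: "convex ?U" "convex ?L"
    using cvS by (auto intro!: convex_Int convex_halfspace_Im_gt convex_halfspace_Im_lt)
  have bdU: "norm (W z) \<le> M" if "z \<in> ?U" for z using M that by auto
  have bdL: "norm (W z) \<le> M" if "z \<in> ?L" for z using M that by auto
  obtain P where P: "continuous_on (closure ?U) P" "\<And>z. z \<in> ?U \<Longrightarrow> (P has_field_derivative W z) (at z)"
    by (rule bounded_primitive_extends[OF cv(1) op(1) hol(1) bdU]) blast+
  obtain Q where Q: "continuous_on (closure ?L) Q" "\<And>z. z \<in> ?L \<Longrightarrow> (Q has_field_derivative W z) (at z)"
    by (rule bounded_primitive_extends[OF cv(2) op(2) hol(2) bdL]) blast+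
  have clU: "z \<in> closure ?U" if z: "z \<in> S" "0 \<le> Im z" for z
  proof (rule Lim_in_closed_set[OF closed_closure])
    have lim: "((\<lambda>t. z + \<i> * of_real t) \<longlongrightarrow> z + \<i> * of_real 0) (at_right 0)" by (intro tendsto_intros)
    then show "((\<lambda>t. z + \<i> * of_real t) \<longlongrightarrow> z) (at_right 0)" by simp
    then have "\<forall>\<^sub>F t in at_right 0. z + \<i> * of_real t \<in> S" by (rule topological_tendstoD[OF _ opS z(1)])
    then show "\<forall>\<^sub>F t in at_right 0. z + \<i> * of_real t \<in> closure ?U"
      using eventually_at_right_less[of 0]
      by eventually_elim (rule subsetD[OF closure_subset], use z in auto)
  qed simp
  have clL: "z \<in> closure ?L" if z: "z \<in> S" "Im z \<le> 0" for z
  proof (rule Lim_in_closed_set[OF closed_closure])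
    have lim: "((\<lambda>t. z - \<i> * of_real t) \<longlongrightarrow> z - \<i> * of_real 0) (at_right 0)" by (intro tendsto_intros)
    then show "((\<lambda>t. z - \<i> * of_real t) \<longlongrightarrow> z) (at_right 0)" by simp
    then have "\<forall>\<^sub>F t in at_right 0. z - \<i> * of_real t \<in> S" by (rule topological_tendstoD[OF _ opS z(1)])
    then show "\<forall>\<^sub>F t in at_right 0. z - \<i> * of_real t \<in> closure ?L"
      using eventually_at_right_less[of 0]
      by eventually_elim (rule subsetD[OF closure_subset], use z in auto)
  qed simp
  have same_increment: "P (of_real b) - P (of_real a) = Q (of_real b) - Q (of_real a)"
    if ab: "a \<le> b" "of_real a \<in> S" "of_real b \<in> S" for a b
  proof -
    have abs: "\<bar>a - x0\<bar> < e" "\<bar>b - x0\<bar> < e"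
      using ab by (auto simp: S_def dist_norm norm_minus_commute simp flip: of_real_diff)
    define d where "d = (e - max \<bar>a - x0\<bar> \<bar>b - x0\<bar>) / 2"
    have d: "d > 0" using abs by (auto simp: d_def)
    have inS: "Complex s y \<in> S" if "s \<in> {a..b}" "\<bar>y\<bar> \<le> d" for s y
    proof -
      have "dist (of_real x0) (Complex s y) \<le> \<bar>s - x0\<bar> + \<bar>y\<bar>"
        using cmod_le[of "of_real x0 - Complex s y"] by (simp add: dist_norm)
      also have "\<dots> \<le> max \<bar>a - x0\<bar> \<bar>b - x0\<bar> + d" using that by auto
      also have "\<dots> < e" using d by (simp add: d_def field_simps)
      finally show ?thesis by (simp add: S_def)
    qed
    define y where "y = (\<lambda>k. d * inverse (real (Suc k)))"
    have y: "0 < y k" "y k \<le> d" for k using d by (auto simp: y_def field_simps)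
    have y_lim: "y \<longlonglongrightarrow> 0" unfolding y_def
      using tendsto_mult_right_zero[OF LIMSEQ_inverse_real_of_nat] .
    have y_right: "filterlim y (at_right 0) sequentially"
      unfolding filterlim_at using y_lim y by (auto simp: less_imp_neq[symmetric])
    let ?f = "\<lambda>k s. W (Complex s (y k)) - W (Complex s (- y k))"
    have int: "(?f k has_integral
       (P (Complex b (y k)) - P (Complex a (y k))) - (Q (Complex b (- y k)) - Q (Complex a (- y k)))) {a..b}" for k
      by (intro has_integral_diff has_integral_horizontal ab(1) P(2) Q(2)) (use y[of k] inS in auto)
    have "(\<lambda>k. integral {a..b} (?f k)) \<longlonglongrightarrow> 0"
    proof (rule integral_bounded_tendsto_0[OF _ _ N])
      have "continuous_on {a..b} (\<lambda>s. W (Complex s (y k)))" for k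
        by (rule continuous_on_compose2[OF holomorphic_on_imp_continuous_on[OF hol(1)]])
           (use inS y[of k] in \<open>auto simp: Complex_eq intro!: continuous_intros\<close>)
      moreover have "continuous_on {a..b} (\<lambda>s. W (Complex s (- y k)))" for k
        by (rule continuous_on_compose2[OF holomorphic_on_imp_continuous_on[OF hol(2)]])
           (use inS[of _ "- y k"] y[of k] in \<open>auto simp: Complex_eq intro!: continuous_intros\<close>)
      ultimately show "continuous_on {a..b} (?f k)" for k by (intro continuous_intros)
      show "norm (?f k s) \<le> M + M" if "s \<in> {a..b}" for k s
        by (rule norm_triangle_le_diff) (intro add_mono M; use that y[of k] inS in auto)
      show "(\<lambda>k. ?f k s) \<longlonglongrightarrow> 0" if "s \<in> {a..b} - N" for s
      proof -
        have "of_real s \<in> S" using inS[of s 0] that d by (simp add: complex_of_real_def)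
        from filterlim_compose[OF jump[OF _ this] y_right] that show ?thesis by auto
      qed
    qed
    then have lim0: "(\<lambda>k. (P (Complex b (y k)) - P (Complex a (y k))) - (Q (Complex b (- y k)) - Q (Complex a (- y k)))) \<longlonglongrightarrow> 0"
      unfolding integral_unique[OF int] .
    have Plim: "(\<lambda>k. P (Complex s (y k))) \<longlonglongrightarrow> P (of_real s)" if "s \<in> {a..b}" for s
    proof (rule continuous_on_tendsto_compose[OF P(1)])
      have "(\<lambda>k. Complex s (y k)) \<longlonglongrightarrow> Complex s 0" by (intro tendsto_Complex tendsto_const y_lim)
      then show "(\<lambda>k. Complex s (y k)) \<longlonglongrightarrow> of_real s" by (simp add: complex_of_real_def)
      show "of_real s \<in> closure ?U" using inS[of s 0] that d by (intro clU) (auto simp: complex_of_real_def)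
      show "\<forall>\<^sub>F k in sequentially. Complex s (y k) \<in> closure ?U"
        using inS[OF that] y by (intro always_eventually allI clU) (auto simp: less_imp_le)
    qed
    have Qlim: "(\<lambda>k. Q (Complex s (- y k))) \<longlonglongrightarrow> Q (of_real s)" if "s \<in> {a..b}" for s
    proof (rule continuous_on_tendsto_compose[OF Q(1)])
      have "(\<lambda>k. Complex s (- y k)) \<longlonglongrightarrow> Complex s (-0)" by (intro tendsto_Complex tendsto_const tendsto_minus y_lim)
      then show "(\<lambda>k. Complex s (- y k)) \<longlonglongrightarrow> of_real s" by (simp add: complex_of_real_def)
      show "of_real s \<in> closure ?L" using inS[of s 0] that d by (intro clL) (auto simp: complex_of_real_def)
      show "\<forall>\<^sub>F k in sequentially. Complex s (- y k) \<in> closure ?L"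
        using inS[OF that, of "- y k" for k] y by (intro always_eventually allI clL) (auto simp: less_imp_le abs_of_pos)
    qed
    have "(\<lambda>k. (P (Complex b (y k)) - P (Complex a (y k))) - (Q (Complex b (- y k)) - Q (Complex a (- y k))))
       \<longlonglongrightarrow> (P (of_real b) - P (of_real a)) - (Q (of_real b) - Q (of_real a))"
      by (intro tendsto_diff Plim Qlim) (use ab(1) in auto)
    from LIMSEQ_unique[OF this lim0] show ?thesis by simp
  qed
  define c where "c = P (of_real x0) - Q (of_real x0)"
  define R where "R = (\<lambda>z. if Im z \<le> 0 then Q z + c else P z)"
  have agree: "Q z + c = P z" if z: "z \<in> S" "Im z = 0" for z
  proof -
    obtain x where x: "z = of_real x" using z(2) by (metis complex_is_Real_iff Reals_cases)
    have "e > 0" using z(1) zero_le_dist[of "of_real x0" z] unfolding S_def mem_ball by linarith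
    then have x0: "of_real x0 \<in> S" by (simp add: S_def)
    show ?thesis
      using same_increment[of x x0] same_increment[of x0 x] z(1) x x0
      by (cases "x \<le> x0") (auto simp: c_def algebra_simps)
  qed
  have contR: "continuous_on S R"
    unfolding R_def
    by (rule continuous_on_cases_le)
       (auto intro!: continuous_intros continuous_on_subset[OF P(1)] continuous_on_subset[OF Q(1)] clU clL agree)
  have dR: "(R has_field_derivative W z) (at z)" if z: "z \<in> S" "Im z \<noteq> 0" for z
  proof (cases "Im z > 0")
    case True
    then show ?thesis
      using z by (intro has_field_derivative_transform_within_open[OF P(2) op(1)]) (auto simp: R_def)
  next
    case False
    then have zL: "z \<in> ?L" using z by auto
    have "((\<lambda>z. Q z + c) has_field_derivative W z + 0) (at z)"
      by (intro DERIV_add Q(2)[OF zL] DERIV_const)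
    then have "((\<lambda>z. Q z + c) has_field_derivative W z) (at z)" by simp
    from has_field_derivative_transform_within_open[OF this op(2) zL]
    show ?thesis by (auto simp: R_def)
  qed
  have "R holomorphic_on S"
  proof (rule holomorphic_on_paste_across_line[OF opS _ _ _ contR])
    show "\<i> \<noteq> 0" by simp
    have [simp]: "\<i> \<bullet> z = Im z" for z by (simp add: inner_complex_def)
    show "R holomorphic_on S \<inter> {z. \<i> \<bullet> z < 0}"
      by (rule derivative_imp_holomorphic[OF dR]) auto
    show "R holomorphic_on S \<inter> {z. 0 < \<i> \<bullet> z}"
      by (rule derivative_imp_holomorphic[OF dR]) auto
  qed
  then have "deriv R holomorphic_on S" by (rule holomorphic_deriv[OF _ opS])
  moreover have "deriv R z = W z" if "z \<in> S" "Im z \<noteq> 0" for z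
    by (rule DERIV_imp_deriv[OF dR[OF that]])
  ultimately show ?thesis by (rule that)
qed

section \<open>Reflection of an inner function\<close>

lemma holomorphic_on_compose_exp_i:
  assumes "v holomorphic_on unit_disk" and "\<And>z. z \<in> T \<Longrightarrow> 0 < Im z"
  shows "(\<lambda>z. v (exp (\<i> * z))) holomorphic_on T"
proof -
  have "(v \<circ> (\<lambda>z. exp (\<i> * z))) holomorphic_on T"
    by (rule holomorphic_on_compose_gen[OF _ assms(1)])
       (use assms(2) in \<open>auto intro!: holomorphic_intros\<close>)
  then show ?thesis by (simp add: o_def)
qed

lemma exp_ii_Complex: "exp (\<i> * Complex x y) = of_real (exp (- y)) * cis x"
  by (simp add: exp_eq_polar)

lemma not_in_boundary_spectrumD:
  assumes "\<xi> \<in> unit_circle" "\<xi> \<notin> boundary_spectrum v"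
  obtains c \<epsilon> where "0 < c" "0 < \<epsilon>" "\<And>z. z \<in> unit_disk \<Longrightarrow> z \<in> ball \<xi> \<epsilon> \<Longrightarrow> c \<le> norm (v z)"
proof -
  let ?l = "Liminf (at \<xi> within unit_disk) (\<lambda>z. ereal (norm (v z)))"
  have "?l \<noteq> 0" using assms by (simp add: boundary_spectrum_def)
  moreover have "0 \<le> ?l" by (rule Liminf_bounded) simp
  ultimately have "0 < ?l" by simp
  then obtain c where c: "0 < ereal c" "ereal c < ?l"
    using ereal_dense2[of 0 ?l] by auto
  from less_LiminfD[OF c(2)] have "\<forall>\<^sub>F z in at \<xi> within unit_disk. c < norm (v z)" by simp
  then obtain \<epsilon> where \<epsilon>: "\<epsilon> > 0" "\<And>z. z \<in> unit_disk \<Longrightarrow> z \<noteq> \<xi> \<Longrightarrow> dist z \<xi> < \<epsilon> \<Longrightarrow> c < norm (v z)"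
    unfolding eventually_at by auto
  show ?thesis
  proof
    show "0 < c" "0 < \<epsilon>" using c \<epsilon> by auto
    fix z assume "z \<in> unit_disk" "z \<in> ball \<xi> \<epsilon>"
    moreover have "z \<noteq> \<xi>" using assms(1) calculation by auto
    ultimately show "c \<le> norm (v z)" using \<epsilon>(2)[of z] by (auto simp: dist_commute)
  qed
qed

text \<open>
  A unimodular number equals its reflection \<open>1 / cnj \<zeta>\<close>.
\<close>
lemma reflected_jump_tendsto_0:
  assumes "unimodular_radial_limit v x"
  shows "((\<lambda>y. v (exp (\<i> * Complex x y)) - 1 / cnj (v (exp (\<i> * Complex x y)))) \<longlongrightarrow> 0) (at_right 0)"
proof -
  obtain \<zeta> where \<zeta>: "norm \<zeta> = 1" "((\<lambda>r::real. v (of_real r * cis x)) \<longlongrightarrow> \<zeta>) (at_left 1)"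
    using assms by (auto simp: unimodular_radial_limit_def)
  have "((\<lambda>y. exp (- y)) \<longlongrightarrow> exp (- 0)) (at_right (0::real))" by (intro tendsto_intros)
  moreover have "\<forall>\<^sub>F y in at_right (0::real). exp (- y) \<in> {..<1} \<and> exp (- y) \<noteq> 1"
    using eventually_at_right_less[of "0::real"] by eventually_elim auto
  ultimately have "filterlim (\<lambda>y. exp (- y)) (at_left 1) (at_right (0::real))"
    by (simp add: filterlim_at)
  from filterlim_compose[OF \<zeta>(2) this]
  have lim: "((\<lambda>y. v (exp (\<i> * Complex x y))) \<longlongrightarrow> \<zeta>) (at_right 0)" by (simp add: exp_ii_Complex)
  have "((\<lambda>y. v (exp (\<i> * Complex x y)) - 1 / cnj (v (exp (\<i> * Complex x y)))) \<longlongrightarrow> \<zeta> - 1 / cnj \<zeta>) (at_right 0)"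
    by (intro tendsto_intros lim) (use \<zeta>(1) in auto)
  moreover have "\<zeta> - 1 / cnj \<zeta> = 0"
  proof -
    have "\<zeta> * cnj \<zeta> = 1" "cnj \<zeta> \<noteq> 0" using \<zeta>(1) complex_norm_square[of \<zeta>] by auto
    then show ?thesis by (simp add: eq_divide_eq)
  qed
  ultimately show ?thesis by simp
qed

text \<open>
  The coordinate \<open>z = exp (\<i>\<zeta>)\<close> turns radii into vertical lines, so radial limits become limits towards the
  real line, and \<open>z \<mapsto> 1 / cnj z\<close> becomes complex conjugation. The function to be glued is \<open>v\<close> above the line
  and \<open>1 / cnj v\<close>, reflected, below it; the lower bound on \<open>|v|\<close> near a point outside the boundary
  spectrum keeps the latter bounded.
\<close>
lemma inner_function_reflection_in_strip:
  assumes v: "inner_function v" and \<xi>: "cis x0 \<notin> boundary_spectrum v"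
  obtains e h where "0 < e" "h holomorphic_on ball (of_real x0) e"
    "\<And>z. z \<in> ball (of_real x0) e \<Longrightarrow> 0 < Im z \<Longrightarrow> h z = v (exp (\<i> * z))"
    "\<And>z. z \<in> ball (of_real x0) e \<Longrightarrow> h z * cnj (h (cnj z)) = 1"
proof -
  have hv: "v holomorphic_on unit_disk" using v by (simp add: inner_function_def)
  obtain B where B: "0 < B" "\<And>z. z \<in> unit_disk \<Longrightarrow> norm (v z) \<le> B"
    by (rule inner_function_bound[OF v]) blast
  obtain c \<epsilon> where c: "0 < c" "0 < \<epsilon>" "\<And>z. z \<in> unit_disk \<Longrightarrow> z \<in> ball (cis x0) \<epsilon> \<Longrightarrow> c \<le> norm (v z)"
    by (rule not_in_boundary_spectrumD[OF _ \<xi>]) auto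
  let ?E = "\<lambda>z. exp (\<i> * z)"
  have E0: "?E (of_real x0) = cis x0" by (simp add: cis_conv_exp)
  have "isCont ?E (of_real x0)" by (intro continuous_intros)
  then obtain e where e: "e > 0" "\<And>z. dist z (of_real x0) < e \<Longrightarrow> dist (?E z) (cis x0) < \<epsilon>"
    unfolding continuous_at_eps_delta E0 using c(2) by blast
  define S where "S = ball (complex_of_real x0) e"
  have cnjS: "cnj z \<in> S" if "z \<in> S" for z
    using that complex_mod_cnj[of "of_real x0 - z"] by (simp add: S_def dist_norm del: complex_mod_cnj)
  have vb: "c \<le> norm (v (?E z))" "norm (v (?E z)) \<le> B" if "z \<in> S" "Im z > 0" for z
    using that e(2)[of z] by (auto simp: S_def dist_commute intro!: c(3) B(2))
  define W where "W = (\<lambda>z. if 0 < Im z then v (?E z) else 1 / cnj (v (?E (cnj z))))"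
  have holU: "W holomorphic_on S \<inter> {z. 0 < Im z}"
    by (rule holomorphic_transform[OF holomorphic_on_compose_exp_i[OF hv]]) (auto simp: W_def)
  have holL: "W holomorphic_on S \<inter> {z. Im z < 0}"
  proof -
    have "cnj \<circ> (\<lambda>z. v (?E z)) \<circ> cnj holomorphic_on S \<inter> {z. Im z < 0}"
      by (intro holomorphic_on_compose_cnj_cnj holomorphic_on_compose_exp_i[OF hv])
         (auto simp: S_def intro!: open_Int open_halfspace_Im_lt)
    then have "(\<lambda>z. 1 / (cnj \<circ> (\<lambda>z. v (?E z)) \<circ> cnj) z) holomorphic_on S \<inter> {z. Im z < 0}"
    proof (intro holomorphic_intros)
      fix z assume "z \<in> S \<inter> {z. Im z < 0}"
      then show "(cnj \<circ> (\<lambda>z. v (?E z)) \<circ> cnj) z \<noteq> 0"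
        using vb(1)[of "cnj z"] cnjS c(1) by auto
    qed
    then show ?thesis by (rule holomorphic_transform) (auto simp: W_def)
  qed
  have bdW: "norm (W z) \<le> max B (1 / c)" if z: "z \<in> S" "Im z \<noteq> 0" for z
  proof (cases "Im z > 0")
    case True
    then show ?thesis using vb(2)[OF z(1)] by (simp add: W_def max.coboundedI1)
  next
    case False
    then have "c \<le> norm (v (?E (cnj z)))" using vb(1)[of "cnj z"] cnjS z by auto
    then have "1 / norm (v (?E (cnj z))) \<le> 1 / c" using c(1) by (intro frac_le) auto
    then show ?thesis using False by (simp add: W_def norm_divide max.coboundedI2)
  qed
  have jump: "((\<lambda>y. W (Complex x y) - W (Complex x (-y))) \<longlongrightarrow> 0) (at_right 0)"
    if "x \<notin> {t. \<not> unimodular_radial_limit v t}" for x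
  proof -
    have "\<forall>\<^sub>F y in at_right (0::real). v (?E (Complex x y)) - 1 / cnj (v (?E (Complex x y))) = W (Complex x y) - W (Complex x (-y))"
      using eventually_at_right_less[of "0::real"]
      by eventually_elim (auto simp: W_def complex_cnj)
    with reflected_jump_tendsto_0 show ?thesis
      by (rule Lim_transform_eventually) (use that in auto)
  qed
  obtain h where h: "h holomorphic_on S" "\<And>z. z \<in> S \<Longrightarrow> Im z \<noteq> 0 \<Longrightarrow> h z = W z"
    using holomorphic_extends_across_real_line[of W x0 e, folded S_def,
      OF holU holL bdW inner_function_negligible_exceptional_set[OF v] jump] by blast
  have off_line: "h z * cnj (h (cnj z)) = 1" if z: "z \<in> S" "Im z \<noteq> 0" for z
  proof -
    have "v (?E (if Im z > 0 then z else cnj z)) \<noteq> 0"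
      using vb(1)[of "if Im z > 0 then z else cnj z"] z cnjS c(1) by (auto split: if_splits)
    then show ?thesis
      using h(2)[OF z] h(2)[OF cnjS[OF z(1)]] z(2) by (auto simp: W_def split: if_splits)
  qed
  have refl: "h z * cnj (h (cnj z)) = 1" if z: "z \<in> S" for z
  proof (cases "Im z = 0")
    case False
    then show ?thesis using off_line z by simp
  next
    case True
    have opS: "open S" by (simp add: S_def)
    have ch: "isCont h w" if "w \<in> S" for w
      using holomorphic_on_imp_continuous_on[OF h(1)] that opS continuous_on_eq_continuous_at by blast
    have t0: "((\<lambda>t. z + \<i> * of_real t) \<longlongrightarrow> z + \<i> * of_real 0) (at_right 0)" by (intro tendsto_intros)
    then have t: "((\<lambda>t. z + \<i> * of_real t) \<longlongrightarrow> z) (at_right 0)" by simp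
    have tc: "((\<lambda>t. cnj (z + \<i> * of_real t)) \<longlongrightarrow> cnj z) (at_right 0)" by (rule tendsto_cnj[OF t])
    have "((\<lambda>t. h (z + \<i> * of_real t) * cnj (h (cnj (z + \<i> * of_real t)))) \<longlongrightarrow> h z * cnj (h (cnj z))) (at_right 0)"
      by (intro tendsto_mult tendsto_cnj isCont_tendsto_compose[OF ch t] isCont_tendsto_compose[OF ch tc] z cnjS)
    moreover have "\<forall>\<^sub>F t in at_right 0. h (z + \<i> * of_real t) * cnj (h (cnj (z + \<i> * of_real t))) = 1"
      using topological_tendstoD[OF t opS z] eventually_at_right_less[of 0]
      by eventually_elim (rule off_line, use True in auto)
    ultimately have "((\<lambda>t::real. 1) \<longlongrightarrow> h z * cnj (h (cnj z))) (at_right 0)"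
      by (rule Lim_transform_eventually)
    then show ?thesis by (simp add: tendsto_const_iff)
  qed
  show ?thesis
  proof
    show "e > 0" "h holomorphic_on ball (of_real x0) e" using e h by (simp_all add: S_def)
    show "h z = v (?E z)" if "z \<in> ball (of_real x0) e" "0 < Im z" for z
      using h(2)[of z] that by (simp add: S_def W_def)
    show "h z * cnj (h (cnj z)) = 1" if "z \<in> ball (of_real x0) e" for z
      using refl that by (simp add: S_def)
  qed
qed

text \<open>
  The continuation in the logarithmic coordinate, transported back by the branch of the logarithm that
  sends \<open>\<xi>\<close> to \<open>0\<close>.
\<close>
lemma inner_function_extends:
  assumes v: "inner_function v" and \<xi>: "\<xi> \<in> unit_circle" "\<xi> \<notin> boundary_spectrum v"
  obtains \<delta> V where "0 < \<delta>" "V holomorphic_on ball \<xi> \<delta>"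
    "\<And>z. z \<in> ball \<xi> \<delta> \<Longrightarrow> z \<in> unit_disk \<Longrightarrow> V z = v z"
    "\<And>z. z \<in> ball \<xi> \<delta> \<Longrightarrow> V z * cnj (V (1 / cnj z)) = 1"
proof -
  define x0 where "x0 = Arg \<xi>"
  have \<xi>0: "\<xi> \<noteq> 0" using \<xi> by auto
  have x0: "\<xi> = cis x0" using \<xi> \<xi>0 by (simp add: x0_def cis_Arg sgn_div_norm)
  obtain e h where e: "0 < e" and h: "h holomorphic_on ball (of_real x0) e"
    "\<And>z. z \<in> ball (of_real x0) e \<Longrightarrow> 0 < Im z \<Longrightarrow> h z = v (exp (\<i> * z))"
    "\<And>z. z \<in> ball (of_real x0) e \<Longrightarrow> h z * cnj (h (cnj z)) = 1"
    by (rule inner_function_reflection_in_strip[OF v \<xi>(2)[unfolded x0]]) blast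
  define \<zeta> where "\<zeta> = (\<lambda>z. of_real x0 - \<i> * Ln (z / \<xi>))"
  have "isCont \<zeta> \<xi>"
    unfolding \<zeta>_def by (intro continuous_intros) (use \<xi>0 in auto)
  moreover have "\<zeta> \<xi> = of_real x0" using \<xi>0 by (simp add: \<zeta>_def)
  ultimately obtain r where r: "r > 0" "\<And>z. dist z \<xi> < r \<Longrightarrow> dist (\<zeta> z) (of_real x0) < e"
    unfolding continuous_at_eps_delta using e by metis
  \<comment> \<open>Radius at most \<open>1\<close> keeps \<open>z / \<xi>\<close> off the branch cut of \<open>Ln\<close>.\<close>
  define \<delta> where "\<delta> = min r 1"
  have \<zeta>b: "\<zeta> z \<in> ball (of_real x0) e" if "z \<in> ball \<xi> \<delta>" for z
    using that r(2)[of z] by (auto simp: \<delta>_def dist_commute)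
  have slit: "z / \<xi> \<notin> \<real>\<^sub>\<le>\<^sub>0" if "z \<in> ball \<xi> \<delta>" for z
  proof -
    have "norm (1 - z / \<xi>) = norm ((\<xi> - z) / \<xi>)" using \<xi>0 by (simp add: diff_divide_distrib)
    also have "\<dots> < 1" using that \<xi> by (simp add: norm_divide \<delta>_def dist_norm)
    finally have "\<bar>Re (1 - z / \<xi>)\<bar> < 1" using abs_Re_le_cmod le_less_trans by blast
    then show ?thesis by (auto simp: complex_nonpos_Reals_iff)
  qed
  define V where "V = (\<lambda>z. h (\<zeta> z))"
  show ?thesis
  proof
    show "\<delta> > 0" using r by (simp add: \<delta>_def)
    have "(h \<circ> \<zeta>) holomorphic_on ball \<xi> \<delta>"
    proof (rule holomorphic_on_compose_gen[OF _ h(1)])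
      show "\<zeta> holomorphic_on ball \<xi> \<delta>"
        unfolding \<zeta>_def using slit \<xi>0 by (intro holomorphic_intros) auto
    qed (use \<zeta>b in auto)
    then show "V holomorphic_on ball \<xi> \<delta>" by (simp add: V_def o_def)
    fix z assume z: "z \<in> ball \<xi> \<delta>"
    have z0: "z \<noteq> 0" using slit[OF z] by auto
    have nz: "norm (z / \<xi>) = norm z" using \<xi> by (simp add: norm_divide)
    show "V z = v z" if "z \<in> unit_disk"
    proof -
      have "Im (\<zeta> z) = - ln (norm z)" using z0 \<xi>0 nz by (simp add: \<zeta>_def)
      then have "0 < Im (\<zeta> z)" using that z0 by simp
      moreover have "exp (\<i> * \<zeta> z) = z"
      proof -
        have "exp (\<i> * \<zeta> z) = exp (\<i> * of_real x0) * exp (Ln (z / \<xi>))"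
          by (simp add: \<zeta>_def exp_add[symmetric] algebra_simps)
        also have "\<dots> = z" using z0 \<xi>0 by (simp add: x0 cis_conv_exp)
        finally show ?thesis .
      qed
      ultimately show ?thesis unfolding V_def using h(2)[OF \<zeta>b[OF z]] by simp
    qed
    have "(1 / cnj z) / \<xi> = inverse (cnj (z / \<xi>))"
    proof -
      have "\<xi> * cnj \<xi> = 1" using \<xi> complex_norm_square[of \<xi>] by simp
      then have "cnj \<xi> = 1 / \<xi>" using \<xi>0 by (simp add: field_simps)
      then show ?thesis by (simp add: field_simps)
    qed
    then have "Ln ((1 / cnj z) / \<xi>) = - cnj (Ln (z / \<xi>))"
      using slit[OF z] by (simp add: Ln_inverse cnj_Ln complex_nonpos_Reals_iff del: complex_cnj_divide)
    then have "\<zeta> (1 / cnj z) = cnj (\<zeta> z)" by (simp add: \<zeta>_def)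
    then show "V z * cnj (V (1 / cnj z)) = 1" unfolding V_def using h(3)[OF \<zeta>b[OF z]] by simp
  qed
qed

section \<open>Continuation of model space functions\<close>

text \<open>
  Cauchy--Schwarz for square-summable sequences.
\<close>
lemma norm_suminf_mult_le:
  fixes a b :: "nat \<Rightarrow> complex"
  assumes a: "summable (\<lambda>n. (norm (a n))\<^sup>2)" and b: "summable (\<lambda>n. (norm (b n))\<^sup>2)"
    and K: "(\<Sum>n. (norm (b n))\<^sup>2) \<le> K\<^sup>2" "K \<ge> 0"
  shows "norm (\<Sum>n. a n * b n) \<le> sqrt (\<Sum>n. (norm (a n))\<^sup>2) * K"
proof -
  have fin: "(\<Sum>n<N. norm (a n * b n)) \<le> sqrt (\<Sum>n. (norm (a n))\<^sup>2) * K" for N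
  proof -
    have "(\<Sum>n<N. norm (a n * b n))\<^sup>2 \<le> (\<Sum>n<N. (norm (a n))\<^sup>2) * (\<Sum>n<N. (norm (b n))\<^sup>2)"
      unfolding norm_mult by (rule Cauchy_Schwarz_ineq_sum)
    also have "\<dots> \<le> (\<Sum>n. (norm (a n))\<^sup>2) * K\<^sup>2"
      by (intro mult_mono sum_le_suminf order_trans[OF sum_le_suminf K(1)] a b suminf_nonneg sum_nonneg) auto
    finally have "(\<Sum>n<N. norm (a n * b n)) \<le> sqrt ((\<Sum>n. (norm (a n))\<^sup>2) * K\<^sup>2)"
      by (rule real_le_rsqrt)
    then show ?thesis using K(2) by (simp add: real_sqrt_mult)
  qed
  note sm = summable_l2_mult[OF a b]
  have "norm (\<Sum>n. a n * b n) \<le> (\<Sum>n. norm (a n * b n))" by (rule summable_norm[OF sm])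
  also have "\<dots> \<le> sqrt (\<Sum>n. (norm (a n))\<^sup>2) * K" by (rule suminf_le_const[OF sm fin])
  finally show "norm (\<Sum>n. a n * b n) \<le> sqrt (\<Sum>n. (norm (a n))\<^sup>2) * K" .
qed

text \<open>
  Uniformly bounded \<open>\<ell>\<^sup>2\<close> norms of the \<open>a n z\<close> make the partial sums converge uniformly, since the error is at
  most \<open>K\<close> times the \<open>\<ell>\<^sup>2\<close> norm of a tail of \<open>f\<close>.
\<close>
lemma holomorphic_l2_pairing:
  fixes f :: "nat \<Rightarrow> complex" and a :: "nat \<Rightarrow> complex \<Rightarrow> complex"
  assumes f: "summable (\<lambda>n. (norm (f n))\<^sup>2)" and "open S" and hol: "\<And>n. a n holomorphic_on S"
    and sa: "\<And>z. z \<in> S \<Longrightarrow> summable (\<lambda>n. (norm (a n z))\<^sup>2)"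
    and K: "\<And>z. z \<in> S \<Longrightarrow> (\<Sum>n. (norm (a n z))\<^sup>2) \<le> K\<^sup>2" "K \<ge> 0"
  shows "(\<lambda>z. \<Sum>n. f n * a n z) holomorphic_on S"
proof -
  let ?F = "\<lambda>z. \<Sum>n. f n * a n z" and ?p = "\<lambda>N z. \<Sum>n<N. f n * a n z"
  define T where "T = (\<lambda>N. \<Sum>n. (norm (f (n + N)))\<^sup>2)"
  have T: "(\<lambda>N. sqrt (T N) * K) \<longlonglongrightarrow> 0"
  proof -
    have "(\<lambda>N. sqrt (T N) * K) \<longlonglongrightarrow> sqrt 0 * K"
      unfolding T_def by (intro tendsto_intros suminf_exist_split2 f)
    then show ?thesis by simp
  qed
  have bound: "dist (?p N z) (?F z) \<le> sqrt (T N) * K" if z: "z \<in> S" for N z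
  proof -
    have s: "summable (\<lambda>n. f n * a n z)"
      by (rule summable_norm_cancel[OF summable_l2_mult[OF f sa[OF z]]])
    have "(\<Sum>n. (norm (a (n + N) z))\<^sup>2) \<le> (\<Sum>n. (norm (a n z))\<^sup>2)"
      using suminf_split_initial_segment[OF sa[OF z], of N] by (simp add: sum_nonneg)
    also note K(1)[OF z]
    finally have "norm (\<Sum>n. f (n + N) * a (n + N) z) \<le> sqrt (T N) * K"
      unfolding T_def
      by (intro norm_suminf_mult_le summable_ignore_initial_segment[OF f]
            summable_ignore_initial_segment[OF sa[OF z]] K(2))
    moreover have "?F z - ?p N z = (\<Sum>n. f (n + N) * a (n + N) z)"
      using suminf_split_initial_segment[OF s, of N] by simp
    ultimately show ?thesis by (simp add: dist_norm norm_minus_commute)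
  qed
  have ul: "uniform_limit S ?p ?F sequentially"
  proof (rule uniform_limitI)
    fix e :: real assume "e > 0"
    with T have "\<forall>\<^sub>F N in sequentially. sqrt (T N) * K < e" by (rule order_tendstoD)
    then show "\<forall>\<^sub>F N in sequentially. \<forall>z\<in>S. dist (?p N z) (?F z) < e"
      by eventually_elim (use bound in \<open>blast intro: le_less_trans\<close>)
  qed
  show ?thesis
  proof (rule holomorphic_uniform_sequence[OF \<open>open S\<close>])
    show "?p N holomorphic_on S" for N by (intro holomorphic_intros hol)
    fix x assume "x \<in> S"
    then obtain d where "d > 0" "cball x d \<subseteq> S" using \<open>open S\<close> open_contains_cball by blast
    then show "\<exists>d>0. cball x d \<subseteq> S \<and> uniform_limit (cball x d) ?p ?F sequentially"
      using uniform_limit_on_subset[OF ul] by blast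
  qed
qed

text \<open>
  The conjugates of the Taylor coefficients in \<open>w\<close> of the reproducing kernel
  \<open>(1 - cnj (V z) * v w) / (1 - cnj z * w)\<close>. Here \<open>V\<close> is meant to be a continuation of \<open>v\<close>: the formula is
  then holomorphic in \<open>z\<close> wherever \<open>V\<close> is, also outside the disk.
\<close>
definition kernel_coeff :: "(complex \<Rightarrow> complex) \<Rightarrow> (complex \<Rightarrow> complex) \<Rightarrow> nat \<Rightarrow> complex \<Rightarrow> complex" where
  "kernel_coeff v V n z = z ^ n - V z * (\<Sum>j=0..n. cnj (taylor_coeff v j) * z ^ (n - j))"

lemma kernel_coeff_0: "kernel_coeff v V 0 z = 1 - V z * cnj (taylor_coeff v 0)"
  by (simp add: kernel_coeff_def)

lemma kernel_coeff_Suc: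
  "kernel_coeff v V (Suc n) z = z * kernel_coeff v V n z - V z * cnj (taylor_coeff v (Suc n))"
proof -
  have "(\<Sum>j=0..Suc n. cnj (taylor_coeff v j) * z ^ (Suc n - j)) =
     z * (\<Sum>j=0..n. cnj (taylor_coeff v j) * z ^ (n - j)) + cnj (taylor_coeff v (Suc n))"
    by (simp add: sum_distrib_left Suc_diff_le mult_ac)
  then show ?thesis by (simp add: kernel_coeff_def algebra_simps)
qed

text \<open>
  When \<open>V z * cnj c = 1\<close>, the kernel equals \<open>cnj (V z) / cnj z\<close> times the difference quotient \<open>d\<close> of \<open>v\<close>
  with value \<open>c\<close> at the reflected point \<open>1 / cnj z\<close>: both satisfy the same recursion for the Taylor
  coefficients. A bound for \<open>d\<close> on the disk therefore bounds the \<open>\<ell>\<^sup>2\<close> norm of the coefficients.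
\<close>
lemma kernel_coeff_bound:
  assumes v: "v holomorphic_on unit_disk" and z: "z \<noteq> 0" and refl: "V z * cnj c = 1"
    and d: "d holomorphic_on unit_disk" and M: "\<And>w. w \<in> unit_disk \<Longrightarrow> norm (d w) \<le> M"
    and quot: "\<And>w. w \<in> unit_disk \<Longrightarrow> (w - 1 / cnj z) * d w = v w - c"
  shows "summable (\<lambda>n. (norm (kernel_coeff v V n z))\<^sup>2)"
    and "(\<Sum>n. (norm (kernel_coeff v V n z))\<^sup>2) \<le> (norm (V z) / norm z * M)\<^sup>2"
proof -
  define p where "p = 1 / cnj z"
  have refl': "cnj (V z) * c = 1" using arg_cong[OF refl, of cnj] by simp
  have fd: "(\<lambda>w. (w - p) * d w) has_fps_expansion (fps_X - fps_const p) * fps_expansion d 0"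
    by (intro fps_expansion_intros has_fps_expansion_taylor d)
  have fv: "(\<lambda>w. v w - c) has_fps_expansion fps_expansion v 0 - fps_const c"
    by (intro fps_expansion_intros has_fps_expansion_taylor v)
  have eq: "taylor_coeff (\<lambda>w. (w - p) * d w) n = taylor_coeff (\<lambda>w. v w - c) n" for n
    by (rule taylor_coeff_cong) (use quot in \<open>auto simp: p_def\<close>)
  have d0: "p * taylor_coeff d 0 = c - taylor_coeff v 0"
    using eq[of 0] unfolding taylor_coeff_eqI[OF fd] taylor_coeff_eqI[OF fv]
    by (simp add: taylor_coeff_def algebra_simps)
  have dSuc: "p * taylor_coeff d (Suc n) = taylor_coeff d n - taylor_coeff v (Suc n)" for n
    using eq[of "Suc n"] unfolding taylor_coeff_eqI[OF fd] taylor_coeff_eqI[OF fv]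
    by (simp add: taylor_coeff_def algebra_simps)
  have k: "cnj (kernel_coeff v V n z) = cnj (V z) * (p * taylor_coeff d n)" for n
  proof (induction n)
    case 0
    show ?case unfolding kernel_coeff_0 d0 using refl' by (simp add: algebra_simps)
  next
    case (Suc n)
    have "cnj z * p = 1" using z by (simp add: p_def)
    then have "cnj z * (cnj (V z) * (p * taylor_coeff d n)) = cnj (V z) * taylor_coeff d n"
      by (metis mult.assoc mult.commute mult_1)
    then show ?case unfolding kernel_coeff_Suc dSuc using Suc by (simp add: algebra_simps)
  qed
  have n: "(norm (kernel_coeff v V n z))\<^sup>2 = (norm (V z) / norm z)\<^sup>2 * (norm (taylor_coeff d n))\<^sup>2" for n
  proof -
    have "norm (kernel_coeff v V n z) = norm (cnj (kernel_coeff v V n z))" by simp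
    also have "\<dots> = norm (V z) / norm z * norm (taylor_coeff d n)"
      unfolding k by (simp add: norm_mult norm_divide p_def)
    finally show ?thesis by (simp add: power_mult_distrib power_divide)
  qed
  note s = bounded_summable_taylor[OF d M]
  show "summable (\<lambda>n. (norm (kernel_coeff v V n z))\<^sup>2)"
    unfolding n by (intro summable_mult s)
  show "(\<Sum>n. (norm (kernel_coeff v V n z))\<^sup>2) \<le> (norm (V z) / norm z * M)\<^sup>2"
    unfolding n power_mult_distrib[of _ M] by (subst suminf_mult[OF s(1)], assumption, intro mult_left_mono s(2), auto)
qed

text \<open>
  On the ball around \<open>\<xi>\<close> the quotient is bounded by the derivative of \<open>V\<close>, and off that ball the
  denominator is at least \<open>\<delta> / 2\<close>. The point \<open>p\<close> may lie inside or outside the disk.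
\<close>
lemma difference_quotient_bound:
  assumes v: "v holomorphic_on unit_disk" and B: "\<And>z. z \<in> unit_disk \<Longrightarrow> norm (v z) \<le> B"
    and V: "V holomorphic_on ball \<xi> \<delta>" and ext: "\<And>z. z \<in> ball \<xi> \<delta> \<Longrightarrow> z \<in> unit_disk \<Longrightarrow> V z = v z"
    and L: "\<And>z. z \<in> ball \<xi> \<delta> \<Longrightarrow> norm (deriv V z) \<le> L" and p: "p \<in> ball \<xi> (\<delta> / 2)"
  obtains d where "d holomorphic_on unit_disk"
    "\<And>w. w \<in> unit_disk \<Longrightarrow> norm (d w) \<le> max L ((B + norm (V p)) / (\<delta> / 2))"
    "\<And>w. w \<in> unit_disk \<Longrightarrow> (w - p) * d w = v w - V p"
proof -
  have "\<delta> > 0" using p zero_le_dist[of \<xi> p] unfolding mem_ball by linarith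
  then have p\<delta>: "p \<in> ball \<xi> \<delta>" using p by auto
  define d where "d = (\<lambda>w. if w = p then deriv v p else (v w - V p) / (w - p))"
  have "d holomorphic_on unit_disk"
  proof (cases "p \<in> unit_disk")
    case True
    with ext p\<delta> have "V p = v p" by blast
    show ?thesis unfolding d_def \<open>V p = v p\<close> by (rule pole_lemma_open[OF v open_ball])
  next
    case False
    have "(\<lambda>w. (v w - V p) / (w - p)) holomorphic_on unit_disk"
      by (intro holomorphic_intros v) (use False in auto)
    then show ?thesis
      by (rule holomorphic_transform) (use False in \<open>auto simp: d_def\<close>)
  qed
  moreover have "norm (d w) \<le> max L ((B + norm (V p)) / (\<delta> / 2))" if w: "w \<in> unit_disk" for w
  proof (cases "w = p")
    case True
    have "deriv v p = deriv V p"
    proof (rule complex_derivative_transform_within_open)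
      show "v holomorphic_on unit_disk \<inter> ball \<xi> \<delta>" "V holomorphic_on unit_disk \<inter> ball \<xi> \<delta>"
        using v V by (auto intro: holomorphic_on_subset)
    qed (use True w p\<delta> ext in auto)
    then show ?thesis using L[OF p\<delta>] True by (simp add: d_def)
  next
    case False
    show ?thesis
    proof (cases "w \<in> ball \<xi> \<delta>")
      case True
      have "norm (V w - V p) \<le> L * norm (w - p)"
      proof (rule field_differentiable_bound[OF convex_ball _ L True p\<delta>])
        show "(V has_field_derivative deriv V z) (at z within ball \<xi> \<delta>)" if "z \<in> ball \<xi> \<delta>" for z
          by (rule has_field_derivative_at_within[OF holomorphic_derivI[OF V open_ball that]])
      qed
      then have "norm (d w) \<le> L"
        using False ext[OF True w] by (simp add: d_def norm_divide divide_le_eq)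
      then show ?thesis by simp
    next
      case far: False
      have "dist \<xi> w \<le> dist \<xi> p + dist p w" by (rule dist_triangle)
      then have wp: "norm (w - p) \<ge> \<delta> / 2"
        using far p by (simp add: dist_norm norm_minus_commute)
      have "norm (d w) \<le> (B + norm (V p)) / norm (w - p)"
        using False B[OF w] norm_triangle_ineq4[of "v w" "V p"]
        by (auto simp: d_def norm_divide intro!: divide_right_mono)
      also have "\<dots> \<le> (B + norm (V p)) / (\<delta> / 2)"
        using wp \<open>\<delta> > 0\<close> order_trans[OF norm_ge_zero B[OF w]] by (intro frac_le) auto
      finally show ?thesis by simp
    qed
  qed
  moreover have "(w - p) * d w = v w - V p" if w: "w \<in> unit_disk" for w
    using ext[OF p\<delta>] w by (auto simp: d_def)
  ultimately show ?thesis by (rule that)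
qed

text \<open>
  The kernel is the Szego kernel \<open>s\<close>, which reproduces \<open>f z\<close>, minus \<open>cnj (v z) * v * s\<close>, which is orthogonal
  to the model space because \<open>s\<close> is in \<open>H\<^sup>2\<close>.
\<close>
lemma model_space_kernel_pairing:
  assumes v: "v holomorphic_on unit_disk" and B: "\<And>z. z \<in> unit_disk \<Longrightarrow> norm (v z) \<le> B"
    and f: "f \<in> model_space v" and z: "z \<in> unit_disk" and V: "V z = v z"
  shows "(\<Sum>n. taylor_coeff f n * kernel_coeff v V n z) = f z"
proof -
  have hf: "f holomorphic_on unit_disk" and sf: "summable (\<lambda>n. (norm (taylor_coeff f n))\<^sup>2)"
    using f by (auto simp: model_space_def H2_def Hol_disk_def)
  define s where "s = (\<lambda>w. if w \<in> unit_disk then 1 / (1 - cnj z * w) else 0)"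
  have "(\<lambda>n. cnj z ^ n * w ^ n) sums s w" if "norm w < 1" for w
  proof -
    have "norm (cnj z * w) < 1"
      using that z mult_strict_mono'[of "norm z" 1 "norm w" 1] by (simp add: norm_mult)
    from geometric_sums[OF this] that show ?thesis by (simp add: s_def power_mult_distrib)
  qed
  from taylor_coeff_power_series[OF this]
  have hs: "s holomorphic_on unit_disk" and ts: "taylor_coeff s n = cnj z ^ n" for n by auto
  have "summable (\<lambda>n. ((norm z)\<^sup>2) ^ n)"
    by (rule summable_geometric) (use z in \<open>simp add: abs_square_less_1\<close>)
  then have ss: "summable (\<lambda>n. (norm (taylor_coeff s n))\<^sup>2)"
    by (simp add: ts norm_power power_mult[symmetric] mult.commute)
  have "s \<in> H2" using hs ss by (auto simp: H2_def Hol_disk_def s_def)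
  then have orth: "H2_inner f (\<lambda>w. v w * s w) = 0"
    using f unfolding model_space_def H2_perp_def by blast
  have tvs: "taylor_coeff (\<lambda>w. v w * s w) n = (\<Sum>j=0..n. taylor_coeff v j * cnj z ^ (n - j))" for n
    using taylor_coeff_mult[OF v hs] by (simp add: ts)
  have k: "taylor_coeff f n * kernel_coeff v V n z =
      taylor_coeff f n * z ^ n - v z * (taylor_coeff f n * cnj (taylor_coeff (\<lambda>w. v w * s w) n))" for n
    unfolding kernel_coeff_def V tvs by (simp add: algebra_simps)
  have sm: "summable (\<lambda>n. taylor_coeff f n * cnj (taylor_coeff (\<lambda>w. v w * s w) n))"
    by (rule summable_norm_cancel, rule summable_l2_mult[OF sf])
       (use bounded_mult_H2(1)[OF v B hs ss] in simp)
  then have "(\<lambda>n. taylor_coeff f n * cnj (taylor_coeff (\<lambda>w. v w * s w) n)) sums 0"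
    using orth by (simp add: H2_inner_def sums_iff)
  from sums_diff[OF taylor_sums[OF hf z] sums_mult[OF this, of "v z"]]
  show ?thesis unfolding k by (simp add: sums_iff)
qed

text \<open>
  The kernel pairing makes sense on both sides of the circle and reproduces \<open>f\<close> inside the disk. The
  radius \<open>\<eta>\<close> comes from a uniform bound on the kernels, so it is the same for all \<open>f\<close>.
\<close>
lemma model_space_extends:
  assumes v: "v holomorphic_on unit_disk" and B: "\<And>z. z \<in> unit_disk \<Longrightarrow> norm (v z) \<le> B"
    and \<xi>: "\<xi> \<in> unit_circle" and \<delta>: "\<delta> > 0"
    and V: "V holomorphic_on ball \<xi> \<delta>" and ext: "\<And>z. z \<in> ball \<xi> \<delta> \<Longrightarrow> z \<in> unit_disk \<Longrightarrow> V z = v z"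
    and refl: "\<And>z. z \<in> ball \<xi> \<delta> \<Longrightarrow> V z * cnj (V (1 / cnj z)) = 1"
  obtains \<eta> where "0 < \<eta>"
    "\<And>f. f \<in> model_space v \<Longrightarrow> \<exists>F. F holomorphic_on ball \<xi> \<eta> \<and> (\<forall>z \<in> ball \<xi> \<eta> \<inter> unit_disk. F z = f z)"
proof -
  have \<xi>1: "norm \<xi> = 1" using \<xi> by simp
  have B0: "0 \<le> B" using B[of 0] norm_ge_zero[of "v 0"] by (simp del: norm_ge_zero)
  have cV: "cball \<xi> (\<delta> / 2) \<subseteq> ball \<xi> \<delta>" using \<delta> by auto
  have "deriv V holomorphic_on ball \<xi> \<delta>" by (rule holomorphic_deriv[OF V open_ball])
  then have "bounded (deriv V ` cball \<xi> (\<delta> / 2))" "bounded (V ` cball \<xi> (\<delta> / 2))"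
    using V by (auto intro!: compact_imp_bounded compact_continuous_image holomorphic_on_imp_continuous_on
        intro: holomorphic_on_subset[OF _ cV])
  then obtain L A where L: "\<And>z. z \<in> cball \<xi> (\<delta> / 2) \<Longrightarrow> norm (deriv V z) \<le> L"
      and A: "A > 0" "\<And>z. z \<in> cball \<xi> (\<delta> / 2) \<Longrightarrow> norm (V z) \<le> A"
    unfolding bounded_pos by (metis imageI)
  have "isCont (\<lambda>z. 1 / cnj z) \<xi>" by (intro continuous_intros) (use \<xi>1 in auto)
  moreover have "1 / cnj \<xi> = \<xi>"
    using \<xi>1 complex_norm_square[of \<xi>] by (simp add: divide_eq_eq mult.commute)
  ultimately have "(\<lambda>z. 1 / cnj z) \<midarrow>\<xi>\<rightarrow> \<xi>" by (simp add: isCont_def)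
  from tendstoD[OF this, of "\<delta> / 4"] \<delta>
  obtain r where r: "r > 0" "\<And>z. z \<noteq> \<xi> \<Longrightarrow> dist z \<xi> < r \<Longrightarrow> dist (1 / cnj z) \<xi> < \<delta> / 4"
    unfolding eventually_at by auto
  define \<eta> where "\<eta> = min r (min (\<delta> / 2) (1 / 2))"
  have \<eta>: "\<eta> > 0" using r \<delta> by (simp add: \<eta>_def)
  \<comment> \<open>The bound for \<open>norm (V z) / norm z * norm (d w)\<close>, where \<open>norm z \<ge> 1 / 2\<close> and the difference quotient lives on the ball of radius \<open>\<delta> / 2\<close>.\<close>
  define K where "K = A * 2 * max L ((B + A) / (\<delta> / 4))"
  have K0: "K \<ge> 0" using A B0 \<delta> by (auto simp: K_def intro!: mult_nonneg_nonneg max.coboundedI2)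
  have kb: "summable (\<lambda>n. (norm (kernel_coeff v V n z))\<^sup>2)" "(\<Sum>n. (norm (kernel_coeff v V n z))\<^sup>2) \<le> K\<^sup>2"
    if z: "z \<in> ball \<xi> \<eta>" for z
  proof -
    have p: "1 / cnj z \<in> ball \<xi> (\<delta> / 2 / 2)"
      using r(2)[of z] z \<open>1 / cnj \<xi> = \<xi>\<close> \<delta> by (cases "z = \<xi>") (auto simp: \<eta>_def dist_commute)
    have z2: "z \<in> ball \<xi> (\<delta> / 2)" using z by (auto simp: \<eta>_def)
    have "norm \<xi> \<le> dist \<xi> z + norm z" using norm_triangle_sub[of \<xi> z] by (simp add: dist_norm)
    then have zn: "norm z \<ge> 1 / 2" using z \<xi>1 by (auto simp: \<eta>_def)
    have V2: "V holomorphic_on ball \<xi> (\<delta> / 2)" by (rule holomorphic_on_subset[OF V]) (use \<delta> in auto)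
    obtain d where d: "d holomorphic_on unit_disk"
      "\<And>w. w \<in> unit_disk \<Longrightarrow> norm (d w) \<le> max L ((B + norm (V (1 / cnj z))) / (\<delta> / 2 / 2))"
      "\<And>w. w \<in> unit_disk \<Longrightarrow> (w - 1 / cnj z) * d w = v w - V (1 / cnj z)"
      by (rule difference_quotient_bound[OF v B V2 ext _ p, of L]) (use \<delta> L in \<open>auto\<close>)
    have dM: "norm (d w) \<le> max L ((B + A) / (\<delta> / 4))" if "w \<in> unit_disk" for w
    proof -
      have "norm (V (1 / cnj z)) \<le> A" using p \<delta> by (intro A(2)) auto
      then have "(B + norm (V (1 / cnj z))) / (\<delta> / 2 / 2) \<le> (B + A) / (\<delta> / 4)"
        using \<delta> by (simp add: divide_right_mono)
      with d(2)[OF that] show ?thesis by linarith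
    qed
    have zb: "z \<in> ball \<xi> \<delta>" using z2 \<delta> by auto
    have z0: "z \<noteq> 0" using zn by auto
    note kc = kernel_coeff_bound[where V = V and z = z and c = "V (1 / cnj z)", OF v z0 refl[OF zb] d(1) dM d(3)]
    show "summable (\<lambda>n. (norm (kernel_coeff v V n z))\<^sup>2)" by (rule kc)
    have "norm (V z) / norm z \<le> A / (1 / 2)"
      using A z2 zn by (intro frac_le) auto
    then have "norm (V z) / norm z * max L ((B + A) / (\<delta> / 4)) \<le> K"
      unfolding K_def using A B0 \<delta> by (intro mult_right_mono) (auto intro!: max.coboundedI2)
    then have "(norm (V z) / norm z * max L ((B + A) / (\<delta> / 4)))\<^sup>2 \<le> K\<^sup>2"
      using A B0 \<delta> by (intro power_mono mult_nonneg_nonneg divide_nonneg_nonneg) (auto intro!: max.coboundedI2)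
    with kc(2) show "(\<Sum>n. (norm (kernel_coeff v V n z))\<^sup>2) \<le> K\<^sup>2" by linarith
  qed
  have hk: "kernel_coeff v V n holomorphic_on ball \<xi> \<eta>" for n
    unfolding kernel_coeff_def
    by (intro holomorphic_intros holomorphic_on_subset[OF V] subset_ball) (use \<delta> in \<open>auto simp: \<eta>_def\<close>)
  show ?thesis
  proof
    show "\<eta> > 0" by (rule \<eta>)
    fix f assume f: "f \<in> model_space v"
    let ?F = "\<lambda>z. \<Sum>n. taylor_coeff f n * kernel_coeff v V n z"
    have "summable (\<lambda>n. (norm (taylor_coeff f n))\<^sup>2)" using f by (simp add: model_space_def H2_def)
    then have "?F holomorphic_on ball \<xi> \<eta>"
      by (rule holomorphic_l2_pairing[OF _ open_ball hk kb K0])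
    moreover have "?F z = f z" if "z \<in> ball \<xi> \<eta> \<inter> unit_disk" for z
      by (rule model_space_kernel_pairing[OF v B f]) (use that ext[of z] \<delta> in \<open>auto simp: \<eta>_def\<close>)
    ultimately show "\<exists>F. F holomorphic_on ball \<xi> \<eta> \<and> (\<forall>z \<in> ball \<xi> \<eta> \<inter> unit_disk. F z = f z)" by blast
  qed
qed

section \<open>Multipliers and boundary spectra\<close>

lemma at_within_unit_disk_neq_bot:
  assumes "\<xi> \<in> unit_circle"
  shows "at \<xi> within unit_disk \<noteq> bot"
  using assms by (simp add: trivial_limit_within islimpt_ball)

text \<open>
  The quotient \<open>Q / P\<close> of two functions holomorphic at \<open>\<xi>\<close> has a limit or a pole there, and a pole is
  impossible as the quotient agrees with the bounded \<open>u\<close> on the disk, which accumulates at \<open>\<xi>\<close>.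
\<close>
lemma bounded_quotient_extends:
  assumes P: "P holomorphic_on ball \<xi> r" and Q: "Q holomorphic_on ball \<xi> r" and \<xi>: "\<xi> \<in> unit_circle"
    and nz: "\<beta> \<in> ball \<xi> r" "P \<beta> \<noteq> 0"
    and B: "\<And>z. z \<in> unit_disk \<Longrightarrow> norm (u z) \<le> B"
    and eq: "\<And>z. z \<in> ball \<xi> r \<inter> unit_disk \<Longrightarrow> Q z = P z * u z"
  obtains \<rho> U where "0 < \<rho>" "continuous_on (ball \<xi> \<rho>) U" "\<And>z. z \<in> ball \<xi> \<rho> \<inter> unit_disk \<Longrightarrow> U z = u z"
proof -
  have r: "r > 0" using nz(1) zero_le_dist[of \<xi> \<beta>] unfolding mem_ball by linarith
  obtain \<rho> where \<rho>: "0 < \<rho>" "ball \<xi> \<rho> \<subseteq> ball \<xi> r" "\<And>z. z \<in> ball \<xi> \<rho> - {\<xi>} \<Longrightarrow> P z \<noteq> 0"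
  proof (cases "P \<xi> = 0")
    case True
    have "\<xi> \<in> ball \<xi> r" using r by simp
    from isolated_zeros[OF P open_ball connected_ball this True nz] that
    show ?thesis by metis
  next
    case False
    have "isCont P \<xi>"
      using holomorphic_on_imp_continuous_on[OF P] r by (simp add: continuous_on_eq_continuous_at)
    then have "\<forall>\<^sub>F z in nhds \<xi>. P z \<noteq> 0"
      using False by (intro tendsto_imp_eventually_ne) (simp_all add: continuous_at tendsto_nhds_iff)
    then have "\<forall>\<^sub>F z in nhds \<xi>. z \<in> ball \<xi> r \<and> P z \<noteq> 0"
      using eventually_nhds_in_open[OF open_ball, of \<xi> \<xi> r] r by (auto elim: eventually_elim2)
    then obtain \<rho> where "\<rho> > 0" "\<And>z. dist z \<xi> < \<rho> \<Longrightarrow> z \<in> ball \<xi> r \<and> P z \<noteq> 0"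
      unfolding eventually_nhds_metric by auto
    then show ?thesis by (intro that[of \<rho>]) (auto simp: dist_commute)
  qed
  define q where "q = (\<lambda>z. Q z / P z)"
  have qu: "q z = u z" if "z \<in> ball \<xi> \<rho> \<inter> unit_disk" for z
  proof -
    have "z \<noteq> \<xi>" using that \<xi> by auto
    then show ?thesis using that \<rho>(2,3) eq[of z] by (auto simp: q_def)
  qed
  have an: "P analytic_on {\<xi>}" "Q analytic_on {\<xi>}"
    using P Q r by (auto simp: analytic_at intro!: exI[of _ "ball \<xi> r"])
  have "not_essential q \<xi>"
    unfolding q_def
    by (intro not_essential_divide not_essential_analytic isolated_singularity_at_analytic an)
  moreover have "\<not> is_pole q \<xi>"
  proof
    assume "is_pole q \<xi>"
    then have "filterlim q at_infinity (at \<xi> within unit_disk)"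
      unfolding is_pole_def by (rule filterlim_mono) (auto simp: at_le)
    then have "\<forall>\<^sub>F z in at \<xi> within unit_disk. B < norm (q z)"
      unfolding filterlim_at_infinity_conv_norm_at_top filterlim_at_top_dense by simp
    moreover have "\<forall>\<^sub>F z in at \<xi> within unit_disk. z \<in> ball \<xi> \<rho> \<inter> unit_disk"
      using \<rho>(1) by (auto simp: eventually_at dist_commute intro!: exI[of _ \<rho>])
    ultimately have "\<forall>\<^sub>F z in at \<xi> within unit_disk. False"
      by eventually_elim (use qu B in force)
    then show False using at_within_unit_disk_neq_bot[OF \<xi>] by simp
  qed
  ultimately obtain c where c: "q \<midarrow>\<xi>\<rightarrow> c" by (auto simp: not_essential_def)
  have "continuous_on (ball \<xi> \<rho> - {\<xi>}) q"
    unfolding q_def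
    by (intro continuous_on_divide holomorphic_on_imp_continuous_on holomorphic_on_subset[OF P]
          holomorphic_on_subset[OF Q]) (use \<rho> in auto)
  then have cq: "isCont q z" if "z \<in> ball \<xi> \<rho> - {\<xi>}" for z
    using that by (simp add: continuous_on_eq_continuous_at open_delete)
  have "isCont (\<lambda>z. if z = \<xi> then c else q z) z" if z: "z \<in> ball \<xi> \<rho>" for z
  proof (cases "z = \<xi>")
    case True
    have "(\<lambda>z. if z = \<xi> then c else q z) \<midarrow>\<xi>\<rightarrow> c"
      by (rule Lim_transform_eventually[OF c]) (auto simp: eventually_at_filter)
    then show ?thesis using True by (simp add: isCont_def)
  next
    case False
    have "\<forall>\<^sub>F w in nhds z. w \<in> ball \<xi> \<rho> - {\<xi>}"
      by (rule eventually_nhds_in_open) (use z False in \<open>auto simp: open_delete\<close>)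
    then have "\<forall>\<^sub>F w in nhds z. (if w = \<xi> then c else q w) = q w"
      by eventually_elim auto
    from isCont_cong[OF this] show ?thesis using cq[of z] z False by simp
  qed
  then have "continuous_on (ball \<xi> \<rho>) (\<lambda>z. if z = \<xi> then c else q z)"
    by (simp add: continuous_at_imp_continuous_on)
  moreover have "(if z = \<xi> then c else q z) = u z" if "z \<in> ball \<xi> \<rho> \<inter> unit_disk" for z
    using qu[OF that] that \<xi> by auto
  ultimately show ?thesis using that \<rho>(1) by blast
qed

text \<open>
  At almost every angle near \<open>\<xi>\<close> the radial limit of \<open>u\<close> is the value of \<open>U\<close>, so \<open>|U| = 1\<close> on a dense subset of an
  arc around \<open>\<xi>\<close>, hence at \<open>\<xi>\<close> by continuity.
\<close>
lemma continuous_extension_not_in_boundary_spectrum: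
  assumes u: "inner_function u" and \<xi>: "\<xi> \<in> unit_circle" and \<rho>: "0 < \<rho>"
    and U: "continuous_on (ball \<xi> \<rho>) U" and eq: "\<And>z. z \<in> ball \<xi> \<rho> \<inter> unit_disk \<Longrightarrow> U z = u z"
  shows "\<xi> \<notin> boundary_spectrum u"
proof -
  define x0 where "x0 = Arg \<xi>"
  have x0: "\<xi> = cis x0" using \<xi> cis_Arg[of \<xi>] by (cases "\<xi> = 0") (auto simp: x0_def sgn_div_norm)
  have contU: "isCont U z" if "z \<in> ball \<xi> \<rho>" for z
    using U that by (simp add: continuous_on_eq_continuous_at)
  have norm1: "norm (U (cis t)) = 1" if t: "unimodular_radial_limit u t" "cis t \<in> ball \<xi> \<rho>" for t
  proof -
    obtain \<zeta> where \<zeta>: "norm \<zeta> = 1" "((\<lambda>r::real. u (of_real r * cis t)) \<longlongrightarrow> \<zeta>) (at_left 1)"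
      using t(1) by (auto simp: unimodular_radial_limit_def)
    have "((\<lambda>r::real. of_real r * cis t) \<longlongrightarrow> of_real 1 * cis t) (at_left 1)" by (intro tendsto_intros)
    then have l: "((\<lambda>r::real. of_real r * cis t) \<longlongrightarrow> cis t) (at_left 1)" by simp
    have "\<forall>\<^sub>F r in at_left (1::real). r \<in> {0<..<1}" by (rule eventually_at_left_real) simp
    then have ev: "\<forall>\<^sub>F r in at_left (1::real). U (of_real r * cis t) = u (of_real r * cis t)"
      using topological_tendstoD[OF l open_ball t(2)]
      by eventually_elim (use circle_in_disk in \<open>auto intro!: eq\<close>)
    have "((\<lambda>r::real. U (of_real r * cis t)) \<longlongrightarrow> U (cis t)) (at_left 1)"
      by (rule isCont_tendsto_compose[OF contU[OF t(2)] l])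
    from Lim_transform_eventually[OF this ev] have "((\<lambda>r::real. u (of_real r * cis t)) \<longlongrightarrow> U (cis t)) (at_left 1)" .
    from tendsto_unique[OF _ this \<zeta>(2)] show ?thesis using \<zeta>(1) by simp
  qed
  let ?C = "{t \<in> {t. cis t \<in> cball \<xi> (\<rho> / 2)}. norm (U (cis t)) = 1}"
  have "x0 \<in> ?C"
  proof (rule mem_closed_if_AE_lebesgue_open)
    show "open {t. cis t \<in> ball \<xi> (\<rho> / 2)}"
      using open_vimage[OF open_ball, of cis \<xi> "\<rho> / 2"] by (simp add: vimage_def continuous_on_cis)
    show "closed ?C"
    proof (rule continuous_closed_preimage_constant)
      show "closed {t. cis t \<in> cball \<xi> (\<rho> / 2)}"
        using closed_vimage[OF closed_cball, of cis \<xi> "\<rho> / 2"] by (simp add: vimage_def continuous_on_cis)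
      show "continuous_on {t. cis t \<in> cball \<xi> (\<rho> / 2)} (\<lambda>t. norm (U (cis t)))"
        by (intro continuous_on_norm continuous_on_compose2[OF U] continuous_intros) (use \<rho> in auto)
    qed
    have "AE t in lebesgue. unimodular_radial_limit u t"
      unfolding eventually_ae_filter_negligible
      using inner_function_negligible_exceptional_set[OF u] by blast
    then show "AE t\<in>{t. cis t \<in> ball \<xi> (\<rho> / 2)} in lebesgue. t \<in> ?C"
      by eventually_elim (use norm1 \<rho> in auto)
    show "x0 \<in> {t. cis t \<in> ball \<xi> (\<rho> / 2)}" using \<rho> x0 by simp
  qed
  then have U1: "norm (U \<xi>) = 1" using x0 by simp
  have "(U \<longlongrightarrow> U \<xi>) (at \<xi> within unit_disk)"
    using contU[of \<xi>] \<rho> by (auto simp: isCont_def intro: tendsto_within_subset)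
  then have "((\<lambda>z. ereal (norm (U z))) \<longlongrightarrow> ereal (norm (U \<xi>))) (at \<xi> within unit_disk)"
    by (intro tendsto_intros)
  moreover have "\<forall>\<^sub>F z in at \<xi> within unit_disk. ereal (norm (U z)) = ereal (norm (u z))"
    using \<rho> by (auto simp: eventually_at dist_commute intro!: exI[of _ \<rho>] arg_cong[of _ _ norm] eq)
  ultimately have "((\<lambda>z. ereal (norm (u z))) \<longlongrightarrow> 1) (at \<xi> within unit_disk)"
    unfolding U1 one_ereal_def by (rule Lim_transform_eventually)
  from lim_imp_Liminf[OF at_within_unit_disk_neq_bot[OF \<xi>] this]
  show ?thesis by (simp add: boundary_spectrum_def)
qed

text \<open>
  Together with \<open>multipliers u v \<noteq> {\<lambda>_. 0}\<close> this yields a nonzero multiplier.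
\<close>
lemma zero_in_multipliers: "(\<lambda>_. 0) \<in> multipliers u v"
proof -
  have t: "taylor_coeff (\<lambda>_. 0) n = 0" for n
    using taylor_coeff_eqI[OF has_fps_expansion_0] by simp
  show ?thesis
    by (auto simp: multipliers_def model_space_def H2_perp_def H2_def Hol_disk_def H2_inner_def t)
qed

theorem proposition2p3:
  fixes u v :: "complex \<Rightarrow> complex"
  assumes "inner_function u" and "inner_function v"
    and "multipliers u v \<noteq> {\<lambda>_. 0}"
  shows "boundary_spectrum u \<subseteq> boundary_spectrum v"
proof (rule subsetI, rule ccontr)
  fix \<xi> assume \<xi>u: "\<xi> \<in> boundary_spectrum u" and \<xi>v: "\<xi> \<notin> boundary_spectrum v"
  have \<xi>: "\<xi> \<in> unit_circle" using \<xi>u by (simp add: boundary_spectrum_def)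
  have hu: "u holomorphic_on unit_disk" and hv: "v holomorphic_on unit_disk"
    using assms by (simp_all add: inner_function_def)
  obtain Bu where Bu: "\<And>z. z \<in> unit_disk \<Longrightarrow> norm (u z) \<le> Bu"
    by (rule inner_function_bound[OF assms(1)]) blast
  obtain Bv where Bv: "\<And>z. z \<in> unit_disk \<Longrightarrow> norm (v z) \<le> Bv"
    by (rule inner_function_bound[OF assms(2)]) blast
  obtain \<phi> where \<phi>: "\<phi> \<in> multipliers u v" "\<phi> \<noteq> (\<lambda>_. 0)"
    using assms(3) zero_in_multipliers by blast
  have h\<phi>: "\<phi> holomorphic_on unit_disk" and \<phi>0: "\<And>z. z \<notin> unit_disk \<Longrightarrow> \<phi> z = 0"
    using \<phi>(1) by (auto simp: multipliers_def Hol_disk_def)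
  obtain \<delta> V where "0 < \<delta>" "V holomorphic_on ball \<xi> \<delta>"
    "\<And>z. z \<in> ball \<xi> \<delta> \<Longrightarrow> z \<in> unit_disk \<Longrightarrow> V z = v z"
    "\<And>z. z \<in> ball \<xi> \<delta> \<Longrightarrow> V z * cnj (V (1 / cnj z)) = 1"
    by (rule inner_function_extends[OF assms(2) \<xi> \<xi>v]) blast
  then obtain \<eta> where \<eta>: "0 < \<eta>" and ext:
    "\<And>f. f \<in> model_space v \<Longrightarrow> \<exists>F. F holomorphic_on ball \<xi> \<eta> \<and> (\<forall>z \<in> ball \<xi> \<eta> \<inter> unit_disk. F z = f z)"
    using model_space_extends[OF hv Bv \<xi>] by metis
  have "\<exists>F. F holomorphic_on ball \<xi> \<eta> \<and> (\<forall>z \<in> ball \<xi> \<eta> \<inter> unit_disk. F z = \<phi> z * backward_shift k u z)"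
    if "k > 0" for k
    using ext backward_shift_in_model_space[OF assms(1) that] \<phi>(1) by (auto simp: multipliers_def)
  then obtain F where F: "\<And>k. k > 0 \<Longrightarrow> F k holomorphic_on ball \<xi> \<eta>"
    "\<And>k z. k > 0 \<Longrightarrow> z \<in> ball \<xi> \<eta> \<inter> unit_disk \<Longrightarrow> F k z = \<phi> z * backward_shift k u z"
    by metis
  obtain \<rho> U where "0 < \<rho>" "continuous_on (ball \<xi> \<rho>) U" "\<And>z. z \<in> ball \<xi> \<rho> \<inter> unit_disk \<Longrightarrow> U z = u z"
  proof (cases "\<exists>m>0. taylor_coeff u m \<noteq> 0")
    case False
    \<comment> \<open>Here \<open>u\<close> is constant and extends trivially.\<close>
    have "u z = taylor_coeff u 0" if "z \<in> unit_disk" for z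
    proof -
      have "(\<lambda>n. taylor_coeff u n * z ^ n) = (\<lambda>n. if n = 0 then taylor_coeff u 0 else 0)"
        using False by (metis neq0_conv mult_zero_left power_0 mult_1_right)
      then show ?thesis
        using taylor_sums[OF hu that] sums_single[of 0 "\<lambda>_. taylor_coeff u 0"] sums_unique2 by metis
    qed
    then show ?thesis using that[of 1 "\<lambda>_. taylor_coeff u 0"] by simp
  next
    case True
    then obtain m where m: "m > 0" "taylor_coeff u m \<noteq> 0" by blast
    \<comment> \<open>\<open>P\<close> continues \<open>\<phi>\<close> and \<open>Q\<close> continues \<open>\<phi> * u\<close>.\<close>
    define P where "P = (\<lambda>z. (F m z - z * F (Suc m) z) / taylor_coeff u m)"
    define Q where "Q = (\<lambda>z. z * F 1 z + taylor_coeff u 0 * P z)"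
    have hP: "P holomorphic_on ball \<xi> \<eta>" unfolding P_def
      by (intro holomorphic_intros F) (use m in auto)
    have hQ: "Q holomorphic_on ball \<xi> \<eta>" unfolding Q_def
      by (intro holomorphic_intros F hP) auto
    have P: "P z = \<phi> z" if z: "z \<in> ball \<xi> \<eta> \<inter> unit_disk" for z
    proof -
      have "F m z - z * F (Suc m) z = \<phi> z * (backward_shift m u z - z * backward_shift (Suc m) u z)"
        using F(2)[OF _ z] m(1) by (simp add: algebra_simps)
      also have "\<dots> = \<phi> z * taylor_coeff u m"
        using backward_shift_Suc[OF hu, of z m] z by simp
      finally show ?thesis using m(2) by (simp add: P_def)
    qed
    have Q: "Q z = P z * u z" if z: "z \<in> ball \<xi> \<eta> \<inter> unit_disk" for z
    proof -
      have "Q z = \<phi> z * (z * backward_shift (Suc 0) u z + taylor_coeff u 0)"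
        using F(2)[OF _ z, of 1] by (simp add: Q_def P[OF z] algebra_simps)
      also have "z * backward_shift (Suc 0) u z + taylor_coeff u 0 = u z"
        using backward_shift_Suc[OF hu, of z 0] backward_shift_0[OF hu, of z] z by simp
      finally show ?thesis by (simp add: P[OF z])
    qed
    have ne: "ball \<xi> \<eta> \<inter> unit_disk \<noteq> {}"
    proof -
      have "\<xi> \<in> closure unit_disk" using \<xi> by simp
      then obtain z where "z \<in> unit_disk" "dist z \<xi> < \<eta>" using \<eta> by (meson closure_approachable)
      then show ?thesis by (auto simp: dist_commute)
    qed
    have "\<exists>\<beta> \<in> ball \<xi> \<eta> \<inter> unit_disk. \<phi> \<beta> \<noteq> 0"
    proof (rule ccontr)
      assume "\<not> ?thesis"
      then have zero: "\<phi> w = 0" if "w \<in> ball \<xi> \<eta> \<inter> unit_disk" for w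
        using that by blast
      have "\<phi> z = 0" if "z \<in> unit_disk" for z
        by (rule analytic_continuation_open[OF _ _ ne connected_ball _ h\<phi> holomorphic_on_const zero that]) auto
      then have "\<phi> = (\<lambda>_. 0)" using \<phi>0 by blast
      with \<phi>(2) show False by simp
    qed
    then obtain \<beta> where \<beta>: "\<beta> \<in> ball \<xi> \<eta>" "P \<beta> \<noteq> 0" using P by auto
    show ?thesis
      by (rule bounded_quotient_extends[OF hP hQ \<xi> \<beta> Bu Q]) (assumption, assumption, rule that)
  qed
  then have "\<xi> \<notin> boundary_spectrum u"
    by (rule continuous_extension_not_in_boundary_spectrum[OF assms(1) \<xi>])
  with \<xi>u show False by contradiction
qed

end
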